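(* Let $s\in(0,1)$, let $N\ge 1$ be an integer with $N>2s$, put $2^*_s:=2N/(N-2s)$, and let $\alpha,\beta>1$ be real numbers with $\alpha+\beta\le 2^*_s$. For functionals $f,g$, consider the system $$ (\mathcal S)\qquad \begin{cases} (-\Delta)^s u+\gamma u=\dfrac{\alpha}{\alpha+\beta}|u|^{\alpha-2}u|v|^{\beta}+f(x) & \text{in }\mathbb{R}^N,\\[2mm] (-\Delta)^s v+\gamma v=\dfrac{\beta}{\alpha+\beta}|v|^{\beta-2}v|u|^{\alpha}+g(x) & \text{in }\mathbb{R}^N,\\[1mm] u,\,v>0 & \text{in }\mathbb{R}^N, \end{cases} $$ where $\gamma=0$ if $\alpha+\beta=2^*_s$ and $\gamma=1$ if $\alpha+\beta<2^*_s$; solutions are understood in the weak sense specified in the context. (i) If $\alpha+\beta=2^*_s$, then there exists $d>0$ such that, whenever $f,g$ are nontrivial nonnegative functionals in the dual space $\dot H^s(\mathbb{R}^N)'$ of $\dot H^s(\mathbb{R}^N)$ with $\ker(f)=\ker(g)$ and $0<\max\{\|f\|_{(\dot H^s)'},\|g\|_{(\dot H^s)'}\}\le d$, the system $(\mathcal S)$ admits a nontrivial solution $(\bar u,\bar v)$ such that $\bar u>0$ and $\bar v>0$. (ii) If $\alpha+\beta<2^*_s$, then there exists $d>0$ such that, whenever $f,g$ are nontrivial nonnegative functionals in the dual space $H^{-s}(\mathbb{R}^N)$ of $H^s(\mathbb{R}^N)$ with $\ker(f)=\ker(g)$ and $0<\max\{\|f\|_{H^{-s}},\|g\|_{H^{-s}}\}\le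 d$, the system $(\mathcal S)$ admits a nontrivial solution $(\bar u,\bar v)$ such that $\bar u>0$ and $\bar v>0$. Furthermore, in both cases (i) and (ii), if $f\equiv g$ then the solution $(\bar u,\bar v)$ has the property that $\bar u\not\equiv\bar v$ whenever $\alpha\ne\beta$. Finally, if $\alpha=\beta$ but $f\not\equiv g$, then $\bar u\not\equiv\bar v$.
   Context: The space $\dot H^s(\mathbb{R}^N)$ is the set of $u\in L^{2^*_s}(\mathbb{R}^N)$ with $\iint_{\mathbb{R}^{2N}}\frac{|u(x)-u(y)|^2}{|x-y|^{N+2s}}\,dx\,dy<\infty$, with norm $\|u\|_{\dot H^s}=\left(\iint_{\mathbb{R}^{2N}}\frac{|u(x)-u(y)|^2}{|x-y|^{N+2s}}\,dx\,dy\right)^{1/2}$ and the corresponding inner product $\langle u,\phi\rangle_{\dot H^s}=\iint_{\mathbb{R}^{2N}}\frac{(u(x)-u(y))(\phi(x)-\phi(y))}{|x-y|^{N+2s}}\,dx\,dy$. The space $H^s(\mathbb{R}^N)$ is the standard fractional Sobolev space, with norm $\|u\|_{H^s}=(\|u\|_{L^2}^2+\|u\|_{\dot H^s}^2)^{1/2}$. The norms $\|\cdot\|_{(\dot H^s)'}$ and $\|\cdot\|_{H^{-s}}$ are the corresponding dual norms. All functions are real valued. A functional $f$ in one of these dual spaces is nonnegative if $\langle f,\phi\rangle\ge 0$ for every $\phi\ge 0$ in the underlying space, and nontrivial if $f\ne 0$; $\ker(f)$ denotes its kernel. Here $\langle f,\phi\rangle$ denotes the duality pairing. Definition of solution. If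 $\alpha+\beta=2^*_s$, a pair $(u,v)\in\dot H^s(\mathbb{R}^N)\times\dot H^s(\mathbb{R}^N)$ is a solution of $(\mathcal S)$ if $u,v>0$ in $\mathbb{R}^N$ and $$\langle u,\phi\rangle_{\dot H^s}+\langle v,\psi\rangle_{\dot H^s}=\frac{\alpha}{2^*_s}\int_{\mathbb{R}^N}|u|^{\alpha-2}u|v|^\beta\phi\,dx+\frac{\beta}{2^*_s}\int_{\mathbb{R}^N}|v|^{\beta-2}v|u|^\alpha\psi\,dx+\langle f,\phi\rangle+\langle g,\psi\rangle$$ for every $(\phi,\psi)\in\dot H^s(\mathbb{R}^N)\times\dot H^s(\mathbb{R}^N)$. If $\alpha+\beta<2^*_s$, a pair $(u,v)\in H^s(\mathbb{R}^N)\times H^s(\mathbb{R}^N)$ is a solution of $(\mathcal S)$ if $u,v>0$ in $\mathbb{R}^N$ and $$\langle u,\phi\rangle_{\dot H^s}+\langle v,\psi\rangle_{\dot H^s}+\langle u,\phi\rangle_{L^2}+\langle v,\psi\rangle_{L^2}=\frac{\alpha}{\alpha+\beta}\int_{\mathbb{R}^N}|u|^{\alpha-2}u|v|^\beta\phi\,dx+\frac{\beta}{\alpha+\beta}\int_{\mathbb{R}^N}|v|^{\beta-2}v|u|^\alpha\psi\,dx+\langle f,\phi\rangle+\langle g,\psi\rangle$$ for every $(\phi,\psi)\in H^s(\mathbb{R}^N)\times H^s(\mathbb{R}^N)$. Pointwise (in)equalities between elements of these spaces are understood almost everywhere. *)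

theory Defs
  imports "HOL-Analysis.Analysis"
begin

text \<open>
  Elements of the function spaces are represented by Borel functions on \<open>real ^ 'n\<close>, with
  dimension \<open>N = CARD('n)\<close>, and are identified when they agree almost everywhere. (Every Lebesgue
  measurable function agrees almost everywhere with a Borel function.)
\<close>

definition crit_exp :: "nat \<Rightarrow> real \<Rightarrow> real" where
  "crit_exp N s = 2 * real N / (real N - 2 * s)"

definition Lp_space :: "real \<Rightarrow> (real ^ 'n \<Rightarrow> real) set" where
  "Lp_space p = {u. u \<in> borel_measurable lborel \<and> integrable lborel (\<lambda>x. \<bar>u x\<bar> powr p)}"

definition L2_inner :: "(real ^ 'n \<Rightarrow> real) \<Rightarrow> (real ^ 'n \<Rightarrow> real) \<Rightarrow> real" where
  "L2_inner u \<phi> = (LINT x|lborel. u x * \<phi> x)"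

text \<open>On the diagonal \<open>x = y\<close>, a null set, the quotient below is \<open>0 / 0 = 0\<close>.\<close>

definition Hdot_inner :: "real \<Rightarrow> (real ^ 'n \<Rightarrow> real) \<Rightarrow> (real ^ 'n \<Rightarrow> real) \<Rightarrow> real" where
  "Hdot_inner s u \<phi> =
    (LINT (x, y)|(lborel \<Otimes>\<^sub>M lborel).
       (u x - u y) * (\<phi> x - \<phi> y) / norm (x - y) powr (real CARD('n) + 2 * s))"

definition finite_gagliardo :: "real \<Rightarrow> (real ^ 'n \<Rightarrow> real) \<Rightarrow> bool" where
  "finite_gagliardo s u \<longleftrightarrow>
    integrable (lborel \<Otimes>\<^sub>M lborel)
      (\<lambda>(x, y). \<bar>u x - u y\<bar>\<^sup>2 / norm (x - y) powr (real CARD('n) + 2 * s))"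

definition Hdot_norm :: "real \<Rightarrow> (real ^ 'n \<Rightarrow> real) \<Rightarrow> real" where
  "Hdot_norm s u =
    sqrt (LINT (x, y)|(lborel \<Otimes>\<^sub>M lborel).
       \<bar>u x - u y\<bar>\<^sup>2 / norm (x - y) powr (real CARD('n) + 2 * s))"

definition Hdot_space :: "real \<Rightarrow> (real ^ 'n \<Rightarrow> real) set" where
  "Hdot_space s = {u \<in> Lp_space (crit_exp CARD('n) s). finite_gagliardo s u}"

definition H_space :: "real \<Rightarrow> (real ^ 'n \<Rightarrow> real) set" where
  "H_space s = {u \<in> Lp_space 2. finite_gagliardo s u}"

definition H_norm :: "real \<Rightarrow> (real ^ 'n \<Rightarrow> real) \<Rightarrow> real" where
  "H_norm s u = sqrt (L2_inner u u + (Hdot_norm s u)\<^sup>2)"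

text \<open>
  Functionals on a space \<open>X\<close> of functions with norm \<open>nrm\<close>. Only the values on \<open>X\<close> matter, so
  equality of functionals is equality on \<open>X\<close>. Boundedness makes a functional constant on classes
  of almost everywhere equal functions, since their difference has norm zero.
\<close>

definition dual_space ::
  "('a \<Rightarrow> real) set \<Rightarrow> (('a \<Rightarrow> real) \<Rightarrow> real) \<Rightarrow> (('a \<Rightarrow> real) \<Rightarrow> real) set" where
  "dual_space X nrm =
    {f. (\<forall>\<phi>\<in>X. \<forall>\<psi>\<in>X. f (\<lambda>x. \<phi> x + \<psi> x) = f \<phi> + f \<psi>) \<and>
        (\<forall>c. \<forall>\<phi>\<in>X. f (\<lambda>x. c * \<phi> x) = c * f \<phi>) \<and>
        (\<exists>C. \<forall>\<phi>\<in>X. \<bar>f \<phi>\<bar> \<le> C * nrm \<phi>)}"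

definition dual_norm ::
  "('a \<Rightarrow> real) set \<Rightarrow> (('a \<Rightarrow> real) \<Rightarrow> real) \<Rightarrow> (('a \<Rightarrow> real) \<Rightarrow> real) \<Rightarrow> real" where
  "dual_norm X nrm f = (SUP \<phi>\<in>{\<phi>\<in>X. nrm \<phi> \<le> 1}. \<bar>f \<phi>\<bar>)"

definition functional_eq ::
  "('a \<Rightarrow> real) set \<Rightarrow> (('a \<Rightarrow> real) \<Rightarrow> real) \<Rightarrow> (('a \<Rightarrow> real) \<Rightarrow> real) \<Rightarrow> bool" where
  "functional_eq X f g \<longleftrightarrow> (\<forall>\<phi>\<in>X. f \<phi> = g \<phi>)"

definition nontrivial_functional ::
  "('a \<Rightarrow> real) set \<Rightarrow> (('a \<Rightarrow> real) \<Rightarrow> real) \<Rightarrow> bool" where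
  "nontrivial_functional X f \<longleftrightarrow> \<not> functional_eq X f (\<lambda>_. 0)"

definition functional_ker ::
  "('a \<Rightarrow> real) set \<Rightarrow> (('a \<Rightarrow> real) \<Rightarrow> real) \<Rightarrow> ('a \<Rightarrow> real) set" where
  "functional_ker X f = {\<phi>\<in>X. f \<phi> = 0}"

definition nonneg_functional ::
  "(real ^ 'n \<Rightarrow> real) set \<Rightarrow> ((real ^ 'n \<Rightarrow> real) \<Rightarrow> real) \<Rightarrow> bool" where
  "nonneg_functional X f \<longleftrightarrow> (\<forall>\<phi>\<in>X. (AE x in lborel. \<phi> x \<ge> 0) \<longrightarrow> f \<phi> \<ge> 0)"

definition ae_positive :: "(real ^ 'n \<Rightarrow> real) \<Rightarrow> bool" where
  "ae_positive u \<longleftrightarrow> (AE x in lborel. u x > 0)"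

definition ae_equal :: "(real ^ 'n \<Rightarrow> real) \<Rightarrow> (real ^ 'n \<Rightarrow> real) \<Rightarrow> bool" where
  "ae_equal u v \<longleftrightarrow> (AE x in lborel. u x = v x)"

text \<open>
  Weak solutions for \<open>\<alpha> + \<beta> = crit_exp N s\<close> (where \<open>\<gamma> = 0\<close>) and for
  \<open>\<alpha> + \<beta> < crit_exp N s\<close> (where \<open>\<gamma> = 1\<close>). In both cases the integrals
  converge, by Hoelder's inequality and the Sobolev embedding.
\<close>

definition critical_solution ::
  "real \<Rightarrow> real \<Rightarrow> real \<Rightarrow> ((real ^ 'n \<Rightarrow> real) \<Rightarrow> real) \<Rightarrow> ((real ^ 'n \<Rightarrow> real) \<Rightarrow> real) \<Rightarrow>
    (real ^ 'n \<Rightarrow> real) \<Rightarrow> (real ^ 'n \<Rightarrow> real) \<Rightarrow> bool" where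
  "critical_solution s \<alpha> \<beta> f g u v \<longleftrightarrow>
    u \<in> Hdot_space s \<and> v \<in> Hdot_space s \<and> ae_positive u \<and> ae_positive v \<and>
    (\<forall>\<phi>\<in>Hdot_space s. \<forall>\<psi>\<in>Hdot_space s.
       Hdot_inner s u \<phi> + Hdot_inner s v \<psi> =
         \<alpha> / crit_exp CARD('n) s *
           (LINT x|lborel. \<bar>u x\<bar> powr (\<alpha> - 2) * u x * \<bar>v x\<bar> powr \<beta> * \<phi> x)
         + \<beta> / crit_exp CARD('n) s *
           (LINT x|lborel. \<bar>v x\<bar> powr (\<beta> - 2) * v x * \<bar>u x\<bar> powr \<alpha> * \<psi> x)
         + f \<phi> + g \<psi>)"

definition subcritical_solution ::
  "real \<Rightarrow> real \<Rightarrow> real \<Rightarrow> ((real ^ 'n \<Rightarrow> real) \<Rightarrow> real) \<Rightarrow> ((real ^ 'n \<Rightarrow> real) \<Rightarrow> real) \<Rightarrow>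
    (real ^ 'n \<Rightarrow> real) \<Rightarrow> (real ^ 'n \<Rightarrow> real) \<Rightarrow> bool" where
  "subcritical_solution s \<alpha> \<beta> f g u v \<longleftrightarrow>
    u \<in> H_space s \<and> v \<in> H_space s \<and> ae_positive u \<and> ae_positive v \<and>
    (\<forall>\<phi>\<in>H_space s. \<forall>\<psi>\<in>H_space s.
       Hdot_inner s u \<phi> + Hdot_inner s v \<psi> + L2_inner u \<phi> + L2_inner v \<psi> =
         \<alpha> / (\<alpha> + \<beta>) *
           (LINT x|lborel. \<bar>u x\<bar> powr (\<alpha> - 2) * u x * \<bar>v x\<bar> powr \<beta> * \<phi> x)
         + \<beta> / (\<alpha> + \<beta>) *
           (LINT x|lborel. \<bar>v x\<bar> powr (\<beta> - 2) * v x * \<bar>u x\<bar> powr \<alpha> * \<psi> x)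
         + f \<phi> + g \<psi>)"

definition nontrivial_pair :: "(real ^ 'n \<Rightarrow> real) \<Rightarrow> (real ^ 'n \<Rightarrow> real) \<Rightarrow> bool" where
  "nontrivial_pair u v \<longleftrightarrow> \<not> (ae_equal u (\<lambda>_. 0) \<and> ae_equal v (\<lambda>_. 0))"

end

(*
  Both cases concern the energy form B = <u, v> + gamma <u, v>_{L^2}. For nonnegative functions the
  right-hand sides are monotone in (u, v), because alpha, beta > 1. Starting from (0, 0), one solves
  the linear problem for the next pair by Riesz representation; the weak maximum principle makes the
  iterates nonnegative and increasing, and since p = alpha + beta > 2 they stay in a ball of the
  energy space as soon as f and g are small. The monotone limit is a solution, by dominated
  convergence. It does not vanish because f and g do not, hence it is positive by the strong maximum
  principle. If u = v, subtracting the two equations gives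
  (beta - alpha) / p * int u^(p-1) phi = f phi - g phi, which yields the last two claims.
*)

theory Submission
  imports Defs
begin

subsection \<open>Fractional Sobolev inequalities\<close>

text \<open>At the critical exponent a bounded sequence in the energy space may concentrate or
  escape and have no strongly convergent subsequence, so the limit is taken from order and not from
  compactness: the iterates increase, their nonlinear terms are dominated by that of the limit, and
  one argument serves both exponents. Smallness of the data enters through an invariant ball.
  Testing with the new iterate bounds its energy norm by \<open>3 * S * r powr (p - 1) + d\<close>;
  the 3 counts the terms of a Young-type bound, and since \<open>p - 1 > 1\<close> the first summand
  is at most \<open>r / 2\<close> for a suitable \<open>r\<close>. Elements of the spaces are
  functions, not classes, and \<open>B\<close> is only semidefinite on them. The Sobolev inequality
  turns zero energy into vanishing almost everywhere; it also yields the pointwise convergence of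
  Cauchy sequences and the finiteness of monotone limits, which is why it is proved first.
  Positivity rests on the nonlocal form: nonnegative functions with disjoint supports still interact
  through the kernel, with a definite sign, so a nontrivial nonnegative supersolution cannot vanish
  on a set of positive measure.\<close>

definition gag_diff :: "real \<Rightarrow> (real ^ 'n \<Rightarrow> real) \<Rightarrow> (real ^ 'n) \<times> (real ^ 'n) \<Rightarrow> real" where
  "gag_diff s u z = (u (fst z) - u (snd z)) / norm (fst z - snd z) powr ((real CARD('n) + 2 * s) / 2)"

lemma powr_half_square: "(x powr (a / 2))\<^sup>2 = x powr a" for x a :: real
  by (simp add: power2_eq_square flip: powr_add)

text \<open>This is why \<open>gag_diff\<close> carries half of the exponent: the Gagliardo form
  becomes the L2 product of two difference quotients on the product space.\<close>

lemma gag_diff_mult: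
  fixes u :: "real ^ 'n \<Rightarrow> real"
  shows "gag_diff s u z * gag_diff s \<phi> z =
    (u (fst z) - u (snd z)) * (\<phi> (fst z) - \<phi> (snd z)) / norm (fst z - snd z) powr (real CARD('n) + 2 * s)"
  unfolding gag_diff_def by (simp add: powr_half_square flip: power2_eq_square)

lemma Hdot_inner_eq:
  "Hdot_inner s u \<phi> = (LINT z|(lborel \<Otimes>\<^sub>M lborel). gag_diff s u z * gag_diff s \<phi> z)"
  unfolding Hdot_inner_def gag_diff_mult by (simp add: case_prod_unfold)

lemma finite_gagliardo_eq:
  "finite_gagliardo s u \<longleftrightarrow> integrable (lborel \<Otimes>\<^sub>M lborel) (\<lambda>z. (gag_diff s u z)\<^sup>2)"
  unfolding finite_gagliardo_def power2_eq_square gag_diff_mult by (simp add: case_prod_unfold)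

lemma Hdot_norm_eq: "Hdot_norm s u = sqrt (Hdot_inner s u u)"
  unfolding Hdot_norm_def Hdot_inner_def by (simp add: power2_eq_square)

lemma borel_measurable_gag_diff [measurable]:
  fixes u :: "real ^ 'n \<Rightarrow> real"
  assumes [measurable]: "u \<in> borel_measurable borel"
  shows "gag_diff s u \<in> borel_measurable (lborel \<Otimes>\<^sub>M lborel)"
  unfolding gag_diff_def by measurable

lemma emeasure_ball_vec:
  fixes x :: "real ^ 'n"
  assumes "0 \<le> r"
  shows "emeasure lborel (ball x r) = ennreal (unit_ball_vol CARD('n) * r ^ CARD('n))"
  using emeasure_ball[OF assms, of x] by simp

text \<open>
  Let \<open>k = \<bar>u x\<bar>\<close>. By Chebyshev, \<open>\<bar>u\<bar> \<ge> k / 2\<close> on a set of measure at most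
  \<open>m = (2 / k) powr q * a\<close>. In the ball around \<open>x\<close> of volume \<open>2 * m\<close> there remains a set of measure
  at least \<open>m\<close> on which \<open>\<bar>u x - u y\<bar> \<ge> k / 2\<close>. For the critical \<open>q\<close> the exponent
  \<open>2 + q * (2 * s / N)\<close> is \<open>q\<close>, so that integrating over \<open>x\<close> gives the Sobolev inequality.
\<close>

lemma gagliardo_pointwise_lower_bound:
  fixes u :: "real ^ 'n \<Rightarrow> real" and x :: "real ^ 'n"
  defines "N \<equiv> real CARD('n)" and "c \<equiv> unit_ball_vol CARD('n)"
  assumes [measurable]: "u \<in> borel_measurable borel" and s: "0 < s"
    and a: "0 < a" and q: "0 < q" and ux: "u x \<noteq> 0"
    and fin: "(\<integral>\<^sup>+y. ennreal (\<bar>u y\<bar> powr q) \<partial>lborel) \<le> ennreal a"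
  shows "ennreal ((1/4) * (2 / c) powr - (1 + 2 * s / N) * (2 powr q) powr - (2 * s / N) *
            \<bar>u x\<bar> powr (2 + q * (2 * s / N)) * a powr - (2 * s / N))
         \<le> (\<integral>\<^sup>+y. ennreal ((gag_diff s u (x, y))\<^sup>2) \<partial>lborel)"
proof -
  define k where "k = \<bar>u x\<bar>"
  have k: "k > 0" using ux by (simp add: k_def)
  define m where "m = (2 / k) powr q * a"
  have m: "m > 0" using k a by (simp add: m_def)
  have N: "N > 0" by (simp add: N_def)
  have c: "c > 0" by (simp add: c_def)
  define r where "r = (2 * m / c) powr (1 / N)"
  have r: "r > 0" using m c by (simp add: r_def)
  define bad where "bad = {y. \<bar>u y\<bar> \<ge> k / 2}"
  have [measurable]: "bad \<in> sets borel" unfolding bad_def by measurable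
  have "emeasure lborel bad = (\<integral>\<^sup>+y. indicator bad y \<partial>lborel)" by simp
  also have "\<dots> \<le> (\<integral>\<^sup>+y. ennreal ((2 / k) powr q) * ennreal (\<bar>u y\<bar> powr q) \<partial>lborel)"
  proof (rule nn_integral_mono)
    fix y
    have "1 \<le> (2 / k) powr q * \<bar>u y\<bar> powr q" if "\<bar>u y\<bar> \<ge> k / 2"
    proof -
      have "1 \<le> ((2 / k) * \<bar>u y\<bar>) powr q"
        using that k q by (intro ge_one_powr_ge_zero) (auto simp: field_simps)
      then show ?thesis by (simp add: powr_mult powr_divide)
    qed
    then show "indicator bad y \<le> ennreal ((2 / k) powr q) * ennreal (\<bar>u y\<bar> powr q)"
      by (auto simp: indicator_def bad_def simp flip: ennreal_mult')
  qed
  also have "\<dots> = ennreal ((2 / k) powr q) * (\<integral>\<^sup>+y. ennreal (\<bar>u y\<bar> powr q) \<partial>lborel)"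
    by (rule nn_integral_cmult) measurable
  also have "\<dots> \<le> ennreal ((2 / k) powr q) * ennreal a"
    by (rule mult_left_mono[OF fin]) simp
  also have "\<dots> = ennreal m" using a by (simp add: m_def ennreal_mult')
  finally have bad: "emeasure lborel bad \<le> ennreal m" .
  have "r ^ CARD('n) = r powr N" using r by (simp add: N_def powr_realpow)
  also have "\<dots> = 2 * m / c" using N m c by (simp add: r_def powr_powr)
  finally have rN: "r ^ CARD('n) = 2 * m / c" .
  define good where "good = ball x r - bad"
  have [measurable]: "good \<in> sets borel" unfolding good_def by measurable
  have "ennreal (2 * m) = emeasure lborel (ball x r)"
    using emeasure_ball_vec[of r x, folded c_def] r rN c by simp
  also have "\<dots> \<le> emeasure lborel (good \<union> bad)"
    by (rule emeasure_mono) (auto simp: good_def)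
  also have "\<dots> \<le> emeasure lborel good + emeasure lborel bad"
    by (rule emeasure_subadditive) auto
  also have "\<dots> \<le> emeasure lborel good + ennreal m" using bad by (rule add_left_mono)
  finally have "ennreal m + ennreal m \<le> ennreal m + emeasure lborel good"
    using m by (simp add: add.commute flip: ennreal_plus)
  then have good: "ennreal m \<le> emeasure lborel good"
    by (simp add: ennreal_add_left_cancel_le)
  have "ennreal ((k / 2)\<^sup>2 / r powr (N + 2 * s) * m) = ennreal ((k / 2)\<^sup>2 / r powr (N + 2 * s)) * ennreal m"
    by (rule ennreal_mult') simp
  also have "\<dots> \<le> ennreal ((k / 2)\<^sup>2 / r powr (N + 2 * s)) * emeasure lborel good"
    by (rule mult_left_mono[OF good]) simp
  also have "\<dots> = (\<integral>\<^sup>+y. ennreal ((k / 2)\<^sup>2 / r powr (N + 2 * s)) * indicator good y \<partial>lborel)"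
    by (subst nn_integral_cmult_indicator) auto
  also have "\<dots> \<le> (\<integral>\<^sup>+y. ennreal ((gag_diff s u (x, y))\<^sup>2) \<partial>lborel)"
  proof (rule nn_integral_mono)
    fix y
    have "(k / 2)\<^sup>2 / r powr (N + 2 * s) \<le> (gag_diff s u (x, y))\<^sup>2" if "y \<in> good"
    proof -
      have y: "\<bar>u y\<bar> < k / 2" "norm (x - y) < r" using that by (auto simp: good_def bad_def dist_norm)
      then have "x \<noteq> y" using k by (auto simp: k_def)
      have "k / 2 \<le> \<bar>u x - u y\<bar>" using y unfolding k_def by linarith
      then have "(k / 2)\<^sup>2 \<le> (u x - u y)\<^sup>2" using k by (metis abs_le_square_iff abs_of_pos half_gt_zero)
      moreover have "norm (x - y) powr (N + 2 * s) \<le> r powr (N + 2 * s)"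
        using y s N by (intro powr_mono2) auto
      moreover have "norm (x - y) powr (N + 2 * s) > 0" using \<open>x \<noteq> y\<close> by simp
      ultimately have "(k / 2)\<^sup>2 / r powr (N + 2 * s) \<le> (u x - u y)\<^sup>2 / norm (x - y) powr (N + 2 * s)"
        by (intro frac_le) auto
      then show ?thesis
        using gag_diff_mult[of s u "(x, y)" u] by (simp add: N_def power2_eq_square)
    qed
    then show "ennreal ((k / 2)\<^sup>2 / r powr (N + 2 * s)) * indicator good y \<le> ennreal ((gag_diff s u (x, y))\<^sup>2)"
      by (auto simp: indicator_def intro: ennreal_leI)
  qed
  finally have main: "ennreal ((k / 2)\<^sup>2 / r powr (N + 2 * s) * m) \<le> (\<integral>\<^sup>+y. ennreal ((gag_diff s u (x, y))\<^sup>2) \<partial>lborel)" .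
  \<comment> \<open>What remains is to collect powers. With this \<open>t\<close>,
    \<open>r powr (N + 2 * s)\<close> is \<open>(2 * m / c) powr (1 + t)\<close>, so the factor
    \<open>m\<close> leaves \<open>m powr - t\<close>, and inserting
    \<open>m = (2 / k) powr q * a\<close> separates \<open>k\<close> from \<open>a\<close>.\<close>
  define t where "t = 2 * s / N"
  have "(1 / N) * (N + 2 * s) = 1 + t" using N by (simp add: t_def field_simps)
  then have "r powr (N + 2 * s) = (2 * m / c) powr (1 + t)"
    unfolding r_def powr_powr by simp
  moreover have "2 * m / c = 2 / c * m" by simp
  ultimately have "1 / r powr (N + 2 * s) = (2 / c * m) powr - (1 + t)"
    by (simp only: powr_minus_divide)
  also have "\<dots> = (2 / c) powr - (1 + t) * m powr - (1 + t)"
    by (simp only: powr_mult)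
  finally have e1: "1 / r powr (N + 2 * s) = (2 / c) powr - (1 + t) * m powr - (1 + t)" .
  have e2: "m powr - (1 + t) * m = m powr - t"
    using m powr_add[of m "- (1 + t)" 1] by simp
  have "m powr - t = ((2 / k) powr q) powr - t * a powr - t"
    unfolding m_def by (simp only: powr_mult)
  also have "((2 / k) powr q) powr - t = (2 powr q) powr - t * k powr (q * t)"
    using k by (simp only: powr_divide powr_powr) (simp add: powr_minus field_simps)
  finally have e3: "m powr - t = (2 powr q) powr - t * k powr (q * t) * a powr - t" .
  have e4: "k powr (2 + q * t) = k\<^sup>2 * k powr (q * t)"
    using k by (simp add: powr_add powr_numeral)
  have "(k / 2)\<^sup>2 / r powr (N + 2 * s) * m = (k / 2)\<^sup>2 * (1 / r powr (N + 2 * s)) * m" by simp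
  also have "\<dots> = (k / 2)\<^sup>2 * (2 / c) powr - (1 + t) * (m powr - (1 + t) * m)"
    unfolding e1 by (simp only: ac_simps)
  also have "\<dots> = (1/4) * (2 / c) powr - (1 + t) * (2 powr q) powr - t * k powr (2 + q * t) * a powr - t"
    unfolding e2 e3 e4 power_divide by simp
  finally show ?thesis using main by (simp only: t_def k_def)
qed

text \<open>Fatou's lemma in the form used for truncations, for limits in the energy space and for
  the strong maximum principle: a uniform bound passes to the limit without a majorant.\<close>

lemma nn_integral_le_of_tendsto:
  assumes [measurable]: "\<And>n::nat. f n \<in> borel_measurable M"
    and bound: "\<And>n. (\<integral>\<^sup>+x. f n x \<partial>M) \<le> C"
    and lim: "AE x in M. (\<lambda>n. f n x) \<longlonglongrightarrow> (g x :: ennreal)"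
  shows "(\<integral>\<^sup>+x. g x \<partial>M) \<le> C"
proof -
  have "(\<integral>\<^sup>+x. g x \<partial>M) = (\<integral>\<^sup>+x. liminf (\<lambda>n. f n x) \<partial>M)"
    using lim by (intro nn_integral_cong_AE) (auto elim!: eventually_mono simp: lim_imp_Liminf)
  also have "\<dots> \<le> liminf (\<lambda>n. \<integral>\<^sup>+x. f n x \<partial>M)" by (rule nn_integral_liminf) measurable
  also have "\<dots> \<le> liminf (\<lambda>n. C)" by (intro Liminf_mono always_eventually allI bound)
  also have "\<dots> = C" by (simp add: Liminf_const)
  finally show ?thesis .
qed

lemma integral_le_of_nn_integral_le:
  fixes f :: "'a \<Rightarrow> real"
  assumes [measurable]: "f \<in> borel_measurable M" and "\<And>x. 0 \<le> f x" and "0 \<le> c"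
    and le: "(\<integral>\<^sup>+x. ennreal (f x) \<partial>M) \<le> ennreal c"
  shows "integrable M f" "(LINT x|M. f x) \<le> c"
proof -
  show int: "integrable M f"
    using assms by (intro integrableI_nonneg) (auto intro: le_less_trans)
  have "ennreal (LINT x|M. f x) \<le> ennreal c"
    using le nn_integral_eq_integral[OF int] assms(2) by simp
  then show "(LINT x|M. f x) \<le> c" using assms(3) by simp
qed

lemma Hdot_inner_nonneg: "0 \<le> Hdot_inner s u u"
  unfolding Hdot_inner_eq by (intro integral_nonneg_AE) simp

lemma nn_integral_gag_diff:
  fixes u :: "real ^ 'n \<Rightarrow> real"
  assumes "finite_gagliardo s u"
  shows "(\<integral>\<^sup>+z. ennreal ((gag_diff s u z)\<^sup>2) \<partial>(lborel \<Otimes>\<^sub>M lborel)) = ennreal (Hdot_inner s u u)"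
  using assms unfolding finite_gagliardo_eq Hdot_inner_eq power2_eq_square
  by (intro nn_integral_eq_integral) auto

text \<open>With \<open>a\<close> the integral of \<open>\<bar>u\<bar> powr q\<close>, integrating
  the pointwise bound over \<open>x\<close> gives
  \<open>C * a powr (1 - 2 * s / N) \<le> Hdot_inner s u u\<close>; raising this to the power
  \<open>q / 2\<close> isolates \<open>a\<close>. Membership in \<open>Hdot_space\<close> makes
  \<open>a\<close> finite beforehand.\<close>

theorem fractional_sobolev:
  fixes s :: real
  defines "q \<equiv> crit_exp CARD('n) s"
  assumes s: "0 < s" and Ns: "2 * s < real CARD('n)"
  obtains S where "0 \<le> S"
    "\<And>u :: real ^ 'n \<Rightarrow> real. u \<in> Hdot_space s \<Longrightarrow>
       (LINT x|lborel. \<bar>u x\<bar> powr q) \<le> S * Hdot_inner s u u powr (q / 2)"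
proof -
  define N c where "N = real CARD('n)" and "c = unit_ball_vol N"
  have N: "N > 0" and c: "c > 0" by (simp_all add: N_def c_def)
  have q: "q > 0" using s Ns by (auto simp: q_def crit_exp_def)
  \<comment> \<open>Criticality of \<open>q\<close>: it turns the pointwise exponent
    \<open>2 + q * (2 * s / N)\<close> into \<open>q\<close> and makes the final exponent of
    \<open>a\<close> equal to 1.\<close>
  have qN: "q * (1 - 2 * s / N) = 2"
    using s Ns N unfolding q_def crit_exp_def N_def[symmetric] by (simp add: field_simps)
  define C where "C = (1/4) * (2 / c) powr - (1 + 2 * s / N) * (2 powr q) powr - (2 * s / N)"
  have C: "C > 0" using c by (simp add: C_def)
  have "(LINT x|lborel. \<bar>u x\<bar> powr q) \<le> C powr - (q / 2) * Hdot_inner s u u powr (q / 2)"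
    if u: "u \<in> Hdot_space s" for u :: "real ^ 'n \<Rightarrow> real"
  proof (cases "(LINT x|lborel. \<bar>u x\<bar> powr q) = 0")
    case False
    define a where "a = (LINT x|lborel. \<bar>u x\<bar> powr q)"
    have "a \<ge> 0" unfolding a_def by (rule integral_nonneg_AE) simp
    with False have a: "a > 0" unfolding a_def by linarith
    have [measurable]: "u \<in> borel_measurable borel" and int: "integrable lborel (\<lambda>x. \<bar>u x\<bar> powr q)"
      and fin: "finite_gagliardo s u"
      using u by (auto simp: Hdot_space_def Lp_space_def q_def)
    have A: "(\<integral>\<^sup>+x. ennreal (\<bar>u x\<bar> powr q) \<partial>lborel) = ennreal a"
      unfolding a_def using int by (intro nn_integral_eq_integral) auto
    have pw: "ennreal (C * a powr - (2 * s / N)) * ennreal (\<bar>u x\<bar> powr q)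
        \<le> (\<integral>\<^sup>+y. ennreal ((gag_diff s u (x, y))\<^sup>2) \<partial>lborel)" for x
    proof (cases "u x = 0")
      case False
      have e: "2 + q * (2 * s / N) = q" using qN by (simp add: algebra_simps)
      show ?thesis
        using gagliardo_pointwise_lower_bound[of u s a q x, folded N_def, folded c_def, unfolded e,
            OF _ s a q False eq_refl[OF A]] C
        by (simp add: C_def ac_simps flip: ennreal_mult')
    qed (use q in auto)
    have "ennreal (C * a powr - (2 * s / N) * a) = ennreal (C * a powr - (2 * s / N)) * ennreal a"
      using C by (intro ennreal_mult') auto
    also have "\<dots> = (\<integral>\<^sup>+x. ennreal (C * a powr - (2 * s / N)) * ennreal (\<bar>u x\<bar> powr q) \<partial>lborel)"
      unfolding A[symmetric] by (rule nn_integral_cmult[symmetric]) measurable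
    also have "\<dots> \<le> (\<integral>\<^sup>+x. (\<integral>\<^sup>+y. ennreal ((gag_diff s u (x, y))\<^sup>2) \<partial>lborel) \<partial>lborel)"
      by (rule nn_integral_mono) (rule pw)
    also have "\<dots> = (\<integral>\<^sup>+z. ennreal ((gag_diff s u z)\<^sup>2) \<partial>(lborel \<Otimes>\<^sub>M lborel))"
      by (rule lborel.nn_integral_fst) measurable
    also have "\<dots> = ennreal (Hdot_inner s u u)" by (rule nn_integral_gag_diff[OF fin])
    finally have "C * a powr - (2 * s / N) * a \<le> Hdot_inner s u u"
      by (simp add: Hdot_inner_nonneg)
    moreover have "a powr - (2 * s / N) * a = a powr (1 - 2 * s / N)"
      using a powr_add[of a "- (2 * s / N)" 1] by simp
    ultimately have "C * a powr (1 - 2 * s / N) \<le> Hdot_inner s u u"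
      by (simp only: mult.assoc)
    then have "a powr (1 - 2 * s / N) \<le> Hdot_inner s u u / C" using C by (simp add: field_simps)
    then have "(a powr (1 - 2 * s / N)) powr (q / 2) \<le> (Hdot_inner s u u / C) powr (q / 2)"
      using q by (intro powr_mono2) auto
    also have "(a powr (1 - 2 * s / N)) powr (q / 2) = a"
      using a qN by (simp add: powr_powr mult.commute)
    also have "(Hdot_inner s u u / C) powr (q / 2) = C powr - (q / 2) * Hdot_inner s u u powr (q / 2)"
      by (simp add: powr_divide powr_minus field_simps)
    finally show ?thesis unfolding a_def .
  qed simp
  then show thesis using that[of "C powr - (q / 2)"] powr_ge_zero by blast
qed

section \<open>Truncation and the embedding of \<open>H_space\<close>\<close>

lemma gag_diff_contraction:
  assumes "\<And>a b. \<bar>T a - T b\<bar> \<le> \<bar>a - b\<bar>"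
  shows "(gag_diff s (\<lambda>x. T (u x)) z)\<^sup>2 \<le> (gag_diff s u z)\<^sup>2"
  using assms[of "u (fst z)" "u (snd z)"]
  by (simp add: gag_diff_def power_divide divide_right_mono abs_le_square_iff)

lemma finite_gagliardo_contraction:
  assumes T: "\<And>a b. \<bar>T a - T b\<bar> \<le> \<bar>a - b\<bar>" and [measurable]: "T \<in> borel_measurable borel"
    and [measurable]: "u \<in> borel_measurable borel" and u: "finite_gagliardo s u"
  shows "finite_gagliardo s (\<lambda>x. T (u x))" "Hdot_inner s (\<lambda>x. T (u x)) (\<lambda>x. T (u x)) \<le> Hdot_inner s u u"
proof -
  note * = gag_diff_contraction[of T, OF T]
  show "finite_gagliardo s (\<lambda>x. T (u x))"
    using u unfolding finite_gagliardo_eq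
    by (rule Bochner_Integration.integrable_bound) (simp_all add: *)
  then show "Hdot_inner s (\<lambda>x. T (u x)) (\<lambda>x. T (u x)) \<le> Hdot_inner s u u"
    using u * unfolding finite_gagliardo_eq Hdot_inner_eq
    by (auto simp flip: power2_eq_square intro!: integral_mono simp del: split_paired_All)
qed

text \<open>\<open>fractional_sobolev\<close> presupposes a finite integral of
  \<open>\<bar>u\<bar> powr q\<close>, which is what has to be shown. Truncation at height
  \<open>n\<close> breaks the circle: the q-th power is then at most \<open>n powr (q - 2)\<close>
  times the square of \<open>u\<close>, the energy does not grow, and Fatou removes the truncation
  because the Sobolev bound does not depend on \<open>n\<close>.\<close>

lemma H_space_subset_Hdot_space:
  fixes u :: "real ^ 'n \<Rightarrow> real"
  assumes s: "0 < s" and Ns: "2 * s < real CARD('n)" and u: "u \<in> H_space s"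
  shows "u \<in> Hdot_space s"
proof -
  define q where "q = crit_exp CARD('n) s"
  have q: "q > 2" using s Ns by (auto simp: q_def crit_exp_def field_simps)
  have [measurable]: "u \<in> borel_measurable borel" and int: "integrable lborel (\<lambda>x. (u x)\<^sup>2)"
    and fin: "finite_gagliardo s u"
    using u by (auto simp: H_space_def Lp_space_def)
  from fractional_sobolev[OF s Ns] obtain S where S: "0 \<le> S"
    "\<And>u :: real ^ 'n \<Rightarrow> real. u \<in> Hdot_space s \<Longrightarrow>
       (LINT x|lborel. \<bar>u x\<bar> powr q) \<le> S * Hdot_inner s u u powr (q / 2)"
    unfolding q_def by blast
  define T :: "nat \<Rightarrow> real \<Rightarrow> real" where "T = (\<lambda>n a. max (- real n) (min (real n) a))"
  have [measurable]: "T n \<in> borel_measurable borel" for n unfolding T_def by measurable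
  have T: "\<bar>T n a - T n b\<bar> \<le> \<bar>a - b\<bar>" for n a b unfolding T_def by linarith
  note fT = finite_gagliardo_contraction[of "T _", OF T _ _ fin]
  have Tb: "\<bar>T n a\<bar> powr q \<le> real n powr (q - 2) * a\<^sup>2" for n a
  proof -
    have "\<bar>T n a\<bar> powr q = \<bar>T n a\<bar> powr (q - 2) * \<bar>T n a\<bar>\<^sup>2"
      using powr_add[of "\<bar>T n a\<bar>" "q - 2" 2] by (simp add: powr_numeral)
    also have "\<dots> \<le> real n powr (q - 2) * a\<^sup>2"
    proof (rule mult_mono)
      have "\<bar>T n a\<bar> \<le> real n" unfolding T_def by linarith
      then show "\<bar>T n a\<bar> powr (q - 2) \<le> real n powr (q - 2)" using q by (intro powr_mono2) auto
      have "\<bar>T n a\<bar> \<le> \<bar>a\<bar>" unfolding T_def by linarith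
      then show "\<bar>T n a\<bar>\<^sup>2 \<le> a\<^sup>2" by (simp add: abs_le_square_iff)
    qed auto
    finally show ?thesis .
  qed
  have TX: "(\<lambda>x. T n (u x)) \<in> Hdot_space s" for n
  proof -
    have "integrable lborel (\<lambda>x. \<bar>T n (u x)\<bar> powr q)"
      by (rule Bochner_Integration.integrable_bound[OF integrable_mult_right[OF int, of "real n powr (q - 2)"]])
        (use Tb in auto)
    then show ?thesis using fT(1)[of n] by (simp add: Hdot_space_def Lp_space_def q_def)
  qed
  have "(\<integral>\<^sup>+x. ennreal (\<bar>u x\<bar> powr q) \<partial>lborel) \<le> ennreal (S * Hdot_inner s u u powr (q / 2))"
  proof (rule nn_integral_le_of_tendsto)
    fix n
    have "(LINT x|lborel. \<bar>T n (u x)\<bar> powr q) \<le> S * Hdot_inner s u u powr (q / 2)"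
      by (rule order_trans[OF S(2)[OF TX]])
        (use q S fT(2)[of n] in \<open>auto intro!: mult_left_mono powr_mono2 Hdot_inner_nonneg\<close>)
    then show "(\<integral>\<^sup>+x. ennreal (\<bar>T n (u x)\<bar> powr q) \<partial>lborel) \<le> ennreal (S * Hdot_inner s u u powr (q / 2))"
      using TX[of n] by (subst nn_integral_eq_integral) (auto simp: Hdot_space_def Lp_space_def q_def intro!: ennreal_leI)
  next
    have ev: "eventually (\<lambda>n. T n a = a) sequentially" for a
    proof -
      obtain n0 :: nat where "\<bar>a\<bar> \<le> real n0" using real_arch_simple by blast
      then have "\<forall>n\<ge>n0. T n a = a" unfolding T_def by (auto simp: max_def min_def)
      then show ?thesis unfolding eventually_sequentially by blast
    qed
    have "\<forall>\<^sub>F n in sequentially. ennreal (\<bar>T n (u x)\<bar> powr q) = ennreal (\<bar>u x\<bar> powr q)" for x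
      using ev[of "u x"] by (rule eventually_mono) simp
    then show "AE x in lborel. (\<lambda>n. ennreal (\<bar>T n (u x)\<bar> powr q)) \<longlonglongrightarrow> ennreal (\<bar>u x\<bar> powr q)"
      by (intro AE_I2 tendsto_eventually)
  qed measurable
  then have "integrable lborel (\<lambda>x. \<bar>u x\<bar> powr q)"
    using S(1) by (intro integral_le_of_nn_integral_le(1)) auto
  then show ?thesis using fin by (simp add: Hdot_space_def Lp_space_def q_def)
qed

lemma integral_square_eq_0_imp_AE:
  fixes u :: "'a \<Rightarrow> real"
  assumes "integrable M (\<lambda>x. (u x)\<^sup>2)" "(LINT x|M. (u x)\<^sup>2) = 0"
  shows "AE x in M. u x = 0"
  using integral_nonneg_eq_0_iff_AE[OF assms(1)] assms(2) by simp

text \<open>The interpolation \<open>pw\<close> between the exponents 2 and \<open>q\<close> is not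
  homogeneous, so it is applied to \<open>u / t\<close>, where \<open>t\<close> is the full energy
  norm. The two summands then contribute at most 1 and \<open>S\<close>.\<close>

lemma subcritical_sobolev:
  fixes s :: real
  assumes s: "0 < s" and Ns: "2 * s < real CARD('n)" and p: "2 < p" "p \<le> crit_exp CARD('n) s"
  obtains S where "0 \<le> S"
    "\<And>u :: real ^ 'n \<Rightarrow> real. u \<in> H_space s \<Longrightarrow> integrable lborel (\<lambda>x. \<bar>u x\<bar> powr p)"
    "\<And>u :: real ^ 'n \<Rightarrow> real. u \<in> H_space s \<Longrightarrow>
       (LINT x|lborel. \<bar>u x\<bar> powr p) \<le> S * (Hdot_inner s u u + L2_inner u u) powr (p / 2)"
proof -
  define q where "q = crit_exp CARD('n) s"
  have pq: "p \<le> q" using p by (simp add: q_def)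
  from fractional_sobolev[OF s Ns] obtain S where S: "0 \<le> S"
    "\<And>u :: real ^ 'n \<Rightarrow> real. u \<in> Hdot_space s \<Longrightarrow>
       (LINT x|lborel. \<bar>u x\<bar> powr q) \<le> S * Hdot_inner s u u powr (q / 2)"
    unfolding q_def by blast
  have pw: "\<bar>b\<bar> powr p \<le> \<bar>b\<bar>\<^sup>2 + \<bar>b\<bar> powr q" for b :: real
  proof (cases "\<bar>b\<bar> \<le> 1")
    case True
    have "\<bar>b\<bar> powr p \<le> \<bar>b\<bar> powr 2"
      using True p powr_mono'[of 2 p "\<bar>b\<bar>"] by (cases "b = 0") auto
    then show ?thesis by (cases "b = 0") (auto simp: powr_numeral intro: add_increasing2)
  next
    case False
    then have "\<bar>b\<bar> powr p \<le> \<bar>b\<bar> powr q" using pq by (intro powr_mono) auto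
    then show ?thesis by (simp add: add_increasing)
  qed
  have main: "integrable lborel (\<lambda>x. \<bar>u x\<bar> powr p) \<and>
      (LINT x|lborel. \<bar>u x\<bar> powr p) \<le> (1 + S) * (Hdot_inner s u u + L2_inner u u) powr (p / 2)"
    if u: "u \<in> H_space s" for u :: "real ^ 'n \<Rightarrow> real"
  proof -
    have uq: "u \<in> Hdot_space s" by (rule H_space_subset_Hdot_space[OF s Ns u])
    have [measurable]: "u \<in> borel_measurable borel" and i2: "integrable lborel (\<lambda>x. (u x)\<^sup>2)"
      and iq: "integrable lborel (\<lambda>x. \<bar>u x\<bar> powr q)"
      using u uq by (auto simp: H_space_def Lp_space_def Hdot_space_def q_def)
    have ip: "integrable lborel (\<lambda>x. \<bar>u x\<bar> powr p)"
      by (rule Bochner_Integration.integrable_bound[OF Bochner_Integration.integrable_add[OF i2 iq]])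
        (use pw in auto)
    define L where "L = L2_inner u u"
    have L: "L = (LINT x|lborel. (u x)\<^sup>2)" by (simp add: L_def L2_inner_def power2_eq_square)
    then have L0: "0 \<le> L" by simp
    define G where "G = Hdot_inner s u u"
    have G0: "0 \<le> G" unfolding G_def by (rule Hdot_inner_nonneg)
    show ?thesis
    proof (cases "G + L = 0")
      case True
      then have "L = 0" using L0 G0 by simp
      then have "AE x in lborel. u x = 0" using L by (intro integral_square_eq_0_imp_AE[OF i2]) simp
      then have "AE x in lborel. \<bar>u x\<bar> powr p = 0" by eventually_elim simp
      then have "(LINT x|lborel. \<bar>u x\<bar> powr p) = 0" by (rule integral_eq_zero_AE)
      then show ?thesis using ip True by (simp add: G_def L_def)
    next
      case False
      define t where "t = sqrt (G + L)"
      have t: "t > 0" and t2: "t\<^sup>2 = G + L" using False G0 L0 by (auto simp: t_def)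
      have tp: "(G + L) powr (r / 2) = t powr r" for r
        using t by (simp add: t2[symmetric] powr_powr flip: powr_numeral)
      have "(LINT x|lborel. \<bar>u x\<bar> powr p) / t powr p = (LINT x|lborel. \<bar>u x / t\<bar> powr p)"
        using t by (simp add: powr_divide)
      also have "\<dots> \<le> (LINT x|lborel. (u x)\<^sup>2 / t\<^sup>2 + \<bar>u x\<bar> powr q / t powr q)"
        using pw[of "u _ / t"] t ip i2 iq
        by (intro integral_mono) (auto simp: powr_divide power_divide)
      also have "\<dots> = L / t\<^sup>2 + (LINT x|lborel. \<bar>u x\<bar> powr q) / t powr q"
        using i2 iq L by simp
      also have "\<dots> \<le> 1 + S"
      proof (rule add_mono)
        show "L / t\<^sup>2 \<le> 1" using G0 L0 False unfolding t2 by (simp add: divide_le_eq)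
        have "(LINT x|lborel. \<bar>u x\<bar> powr q) \<le> S * G powr (q / 2)"
          unfolding G_def by (rule S(2)[OF uq])
        also have "\<dots> \<le> S * (G + L) powr (q / 2)"
          using S G0 L0 p pq by (intro mult_left_mono powr_mono2) auto
        finally show "(LINT x|lborel. \<bar>u x\<bar> powr q) / t powr q \<le> S"
          unfolding tp using t by (simp add: field_simps)
      qed
      finally have "(LINT x|lborel. \<bar>u x\<bar> powr p) \<le> (1 + S) * t powr p"
        using t by (simp add: field_simps)
      then show ?thesis using ip by (simp add: tp flip: G_def L_def)
    qed
  qed
  show thesis by (rule that[of "1 + S"]) (use main S in auto)
qed

section \<open>Products, null sets and sums\<close>

lemma integrable_mult_of_squares:
  fixes f g :: "'a \<Rightarrow> real"
  assumes [measurable]: "f \<in> borel_measurable M" "g \<in> borel_measurable M"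
    and "integrable M (\<lambda>x. (f x)\<^sup>2)" "integrable M (\<lambda>x. (g x)\<^sup>2)"
  shows "integrable M (\<lambda>x. f x * g x)"
proof (rule Bochner_Integration.integrable_bound)
  show "integrable M (\<lambda>x. (f x)\<^sup>2 + (g x)\<^sup>2)" using assms by simp
  have "\<bar>a * b\<bar> \<le> a\<^sup>2 + b\<^sup>2" for a b :: real
  proof -
    have "2 * \<bar>a\<bar> * \<bar>b\<bar> \<le> \<bar>a\<bar>\<^sup>2 + \<bar>b\<bar>\<^sup>2" by (rule sum_squares_bound)
    moreover have "0 \<le> \<bar>a\<bar> * \<bar>b\<bar>" by simp
    ultimately show ?thesis unfolding abs_mult mult.assoc power2_abs by linarith
  qed
  then show "AE x in M. norm (f x * g x) \<le> norm ((f x)\<^sup>2 + (g x)\<^sup>2)" by simp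
qed measurable

text \<open>The exceptional pairs lie in two cylinders over a null set, which are null since 0 times
  infinity is 0 for measures. It carries pointwise facts about \<open>u\<close> over to
  \<open>gag_diff s u\<close>.\<close>

lemma AE_pair_fst_snd:
  fixes P :: "'a::euclidean_space \<Rightarrow> bool"
  assumes "AE x in lborel. P x"
  shows "AE z in (lborel \<Otimes>\<^sub>M lborel). P (fst z) \<and> P (snd z)"
proof -
  obtain N where "{x \<in> space lborel. \<not> P x} \<subseteq> N" and N: "emeasure lborel N = 0" "N \<in> sets lborel"
    using assms by (rule AE_E)
  then have sub: "{x. \<not> P x} \<subseteq> N" by simp
  have "AE z in (lborel \<Otimes>\<^sub>M lborel). fst z \<notin> N \<and> snd z \<notin> N"
  proof (rule AE_I)
    show "{z \<in> space (lborel \<Otimes>\<^sub>M lborel). \<not> (fst z \<notin> N \<and> snd z \<notin> N)} \<subseteq> N \<times> UNIV \<union> UNIV \<times> N" by auto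
    have "emeasure (lborel \<Otimes>\<^sub>M lborel) (N \<times> UNIV \<union> UNIV \<times> N) \<le>
        emeasure (lborel \<Otimes>\<^sub>M lborel) (N \<times> (UNIV :: 'a set)) + emeasure (lborel \<Otimes>\<^sub>M lborel) ((UNIV :: 'a set) \<times> N)"
      by (rule emeasure_subadditive) (use N in auto)
    also have "\<dots> = 0" using N by (simp add: lborel.emeasure_pair_measure_Times)
    finally show "emeasure (lborel \<Otimes>\<^sub>M lborel) (N \<times> UNIV \<union> UNIV \<times> N) = 0" by simp
    show "N \<times> UNIV \<union> UNIV \<times> N \<in> sets (lborel \<Otimes>\<^sub>M lborel)" using N by auto
  qed
  then show ?thesis by eventually_elim (use sub in auto)
qed

lemma gag_diff_AE_cong:
  fixes u v :: "real ^ 'n \<Rightarrow> real"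
  assumes "AE x in lborel. u x = v x"
  shows "AE z in (lborel \<Otimes>\<^sub>M lborel). gag_diff s u z = gag_diff s v z"
  using AE_pair_fst_snd[OF assms] by eventually_elim (simp add: gag_diff_def)

lemma gag_diff_add: "gag_diff s (\<lambda>x. u x + v x) z = gag_diff s u z + gag_diff s v z"
  and gag_diff_scale: "gag_diff s (\<lambda>x. c * u x) z = c * gag_diff s u z"
  by (simp_all add: gag_diff_def algebra_simps add_divide_distrib diff_divide_distrib)

lemma powr_add_le:
  fixes a b p :: real
  assumes "0 \<le> p"
  shows "\<bar>a + b\<bar> powr p \<le> 2 powr p * (\<bar>a\<bar> powr p + \<bar>b\<bar> powr p)"
proof -
  have "\<bar>a + b\<bar> powr p \<le> (2 * max \<bar>a\<bar> \<bar>b\<bar>) powr p"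
    using assms by (intro powr_mono2) auto
  also have "\<dots> = 2 powr p * max \<bar>a\<bar> \<bar>b\<bar> powr p" by (rule powr_mult)
  also have "\<dots> \<le> 2 powr p * (\<bar>a\<bar> powr p + \<bar>b\<bar> powr p)"
    by (intro mult_left_mono) (auto simp: max_def)
  finally show ?thesis .
qed

subsection \<open>The energy space\<close>

text \<open>
  The critical case is \<open>\<gamma> = 0\<close>, \<open>p = crit_exp N s\<close>, \<open>X = Hdot_space s\<close>; the subcritical case is
  \<open>\<gamma> = 1\<close>, \<open>p = \<alpha> + \<beta>\<close>, \<open>X = H_space s\<close>.
\<close>

locale fractional_energy =
  fixes s \<gamma> p S :: real and X :: "(real ^ 'n \<Rightarrow> real) set"
  assumes \<gamma>: "0 \<le> \<gamma>" and p: "2 < p" and S: "0 \<le> S"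
    and X_eq: "X = {u. u \<in> borel_measurable borel \<and> integrable lborel (\<lambda>x. \<bar>u x\<bar> powr p) \<and>
      integrable lborel (\<lambda>x. \<gamma> * (u x)\<^sup>2) \<and> finite_gagliardo s u}"
    and sobolev: "\<And>u. u \<in> X \<Longrightarrow>
      (LINT x|lborel. \<bar>u x\<bar> powr p) \<le> S * (Hdot_inner s u u + \<gamma> * L2_inner u u) powr (p / 2)"
begin

definition B :: "(real ^ 'n \<Rightarrow> real) \<Rightarrow> (real ^ 'n \<Rightarrow> real) \<Rightarrow> real" where
  "B u v = Hdot_inner s u v + \<gamma> * L2_inner u v"

lemma XD:
  assumes "u \<in> X"
  shows "u \<in> borel_measurable borel" "integrable lborel (\<lambda>x. \<bar>u x\<bar> powr p)"
    "integrable lborel (\<lambda>x. \<gamma> * (u x)\<^sup>2)" "finite_gagliardo s u"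
    "integrable (lborel \<Otimes>\<^sub>M lborel) (\<lambda>z. (gag_diff s u z)\<^sup>2)"
  using assms by (auto simp: X_eq finite_gagliardo_eq)

lemma integrable_gag_diff_mult:
  assumes "u \<in> X" "v \<in> X"
  shows "integrable (lborel \<Otimes>\<^sub>M lborel) (\<lambda>z. gag_diff s u z * gag_diff s v z)"
  using XD[OF assms(1)] XD[OF assms(2)] by (intro integrable_mult_of_squares) auto

lemma integrable_L2_mult:
  assumes "u \<in> X" "v \<in> X"
  shows "integrable lborel (\<lambda>x. \<gamma> * (u x * v x))"
proof -
  have "integrable lborel (\<lambda>x. (sqrt \<gamma> * u x) * (sqrt \<gamma> * v x))"
    using XD[OF assms(1)] XD[OF assms(2)] \<gamma>
    by (intro integrable_mult_of_squares) (auto simp: power_mult_distrib)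
  moreover have "(sqrt \<gamma> * u x) * (sqrt \<gamma> * v x) = \<gamma> * (u x * v x)" for x
    using \<gamma> real_sqrt_mult_self[of \<gamma>] by (simp add: algebra_simps)
  ultimately show ?thesis by simp
qed

text \<open>Keeping \<open>\<gamma>\<close> under the integral lets additivity of \<open>B\<close>
  go through for \<open>\<gamma> = 0\<close> too, where \<open>u x * v x\<close> itself may fail to
  be integrable.\<close>

lemma B_eq: "B u v = (LINT z|(lborel \<Otimes>\<^sub>M lborel). gag_diff s u z * gag_diff s v z) +
    (LINT x|lborel. \<gamma> * (u x * v x))"
  unfolding B_def Hdot_inner_eq L2_inner_def by simp

lemma B_commute: "B u v = B v u"
  unfolding B_eq by (simp add: mult.commute)

lemma B_nonneg: "0 \<le> B u u"
  unfolding B_eq using \<gamma> by (intro add_nonneg_nonneg integral_nonneg_AE) auto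

lemma Hdot_inner_le_B: "Hdot_inner s u u \<le> B u u"
  unfolding B_def L2_inner_def using \<gamma> by simp

lemma L2_le_B: "(LINT x|lborel. \<gamma> * (u x)\<^sup>2) \<le> B u u"
  using Hdot_inner_nonneg[of s u] unfolding B_def L2_inner_def by (simp add: power2_eq_square)

lemma X_add:
  assumes u: "u \<in> X" and v: "v \<in> X"
  shows "(\<lambda>x. u x + v x) \<in> X"
proof -
  note [measurable] = XD(1)[OF u] XD(1)[OF v]
  have "integrable lborel (\<lambda>x. \<bar>u x + v x\<bar> powr p)"
    by (rule Bochner_Integration.integrable_bound[OF
          integrable_mult_right[OF Bochner_Integration.integrable_add[OF XD(2)[OF u] XD(2)[OF v]], of "2 powr p"]])
      (use powr_add_le[of p] p in auto)
  moreover have "integrable lborel (\<lambda>x. \<gamma> * (u x + v x)\<^sup>2)"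
  proof -
    have "integrable lborel (\<lambda>x. \<gamma> * (u x)\<^sup>2 + \<gamma> * (v x)\<^sup>2 + 2 * (\<gamma> * (u x * v x)))"
      using XD(3)[OF u] XD(3)[OF v] integrable_L2_mult[OF u v] by (intro Bochner_Integration.integrable_add) auto
    then show ?thesis by (simp add: power2_sum algebra_simps)
  qed
  moreover have "finite_gagliardo s (\<lambda>x. u x + v x)"
  proof -
    have "integrable (lborel \<Otimes>\<^sub>M lborel)
      (\<lambda>z. (gag_diff s u z)\<^sup>2 + (gag_diff s v z)\<^sup>2 + 2 * (gag_diff s u z * gag_diff s v z))"
      using XD(5)[OF u] XD(5)[OF v] integrable_gag_diff_mult[OF u v]
      by (intro Bochner_Integration.integrable_add) auto
    then show ?thesis by (simp add: finite_gagliardo_eq gag_diff_add power2_sum algebra_simps)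
  qed
  ultimately show ?thesis by (simp add: X_eq)
qed

lemma X_scale:
  assumes u: "u \<in> X"
  shows "(\<lambda>x. c * u x) \<in> X"
proof -
  note [measurable] = XD(1)[OF u]
  have "integrable lborel (\<lambda>x. \<gamma> * (c * u x)\<^sup>2)"
    using integrable_mult_right[OF XD(3)[OF u], of "c\<^sup>2"] by (simp add: power_mult_distrib ac_simps)
  then show ?thesis
    using XD(2,5)[OF u] by (simp add: X_eq finite_gagliardo_eq gag_diff_scale power_mult_distrib abs_mult powr_mult)
qed

lemma X_diff: "u \<in> X \<Longrightarrow> v \<in> X \<Longrightarrow> (\<lambda>x. u x - v x) \<in> X"
  using X_add[OF _ X_scale[of v "- 1"], of u] by simp

lemma X_zero: "(\<lambda>x. 0) \<in> X"
  by (simp add: X_eq finite_gagliardo_eq gag_diff_def)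

lemma X_contraction:
  assumes u: "u \<in> X" and T: "\<And>a b. \<bar>T a - T b\<bar> \<le> \<bar>a - b\<bar>" "T 0 = 0"
  shows "(\<lambda>x. T (u x)) \<in> X"
proof -
  note [measurable] = XD(1)[OF u]
  have "1-lipschitz_on UNIV T" using T(1) by (simp add: lipschitz_on_def dist_real_def)
  then have [measurable]: "T \<in> borel_measurable borel"
    by (intro borel_measurable_continuous_onI) (rule lipschitz_on_continuous_on)
  have T0: "\<bar>T a\<bar> \<le> \<bar>a\<bar>" for a using T(1)[of a 0] T(2) by simp
  have "integrable lborel (\<lambda>x. \<bar>T (u x)\<bar> powr p)"
    by (rule Bochner_Integration.integrable_bound[OF XD(2)[OF u]])
      (use T0 p in \<open>auto intro!: powr_mono2\<close>)
  moreover have "integrable lborel (\<lambda>x. \<gamma> * (T (u x))\<^sup>2)"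
    by (rule Bochner_Integration.integrable_bound[OF XD(3)[OF u]])
      (use T0 \<gamma> in \<open>auto intro!: mult_left_mono simp: abs_le_square_iff\<close>)
  moreover have "finite_gagliardo s (\<lambda>x. T (u x))"
    by (rule finite_gagliardo_contraction(1)) (use XD(4)[OF u] T in auto)
  ultimately show ?thesis by (simp add: X_eq)
qed

lemma X_pos_part: "u \<in> X \<Longrightarrow> (\<lambda>x. max 0 (u x)) \<in> X"
  by (rule X_contraction[where T = "max 0"]) auto

lemma B_add_left:
  assumes "u \<in> X" "v \<in> X" "w \<in> X"
  shows "B (\<lambda>x. u x + v x) w = B u w + B v w"
  unfolding B_eq gag_diff_add distrib_left distrib_right
  using integrable_gag_diff_mult[OF assms(1,3)] integrable_gag_diff_mult[OF assms(2,3)]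
    integrable_L2_mult[OF assms(1,3)] integrable_L2_mult[OF assms(2,3)]
  by (simp only: Bochner_Integration.integral_add)

lemma B_scale_left: "B (\<lambda>x. c * u x) w = c * B u w"
proof -
  have "(LINT x|lborel. \<gamma> * (c * u x * w x)) = (LINT x|lborel. c * (\<gamma> * (u x * w x)))"
    by (simp add: ac_simps)
  then show ?thesis unfolding B_eq gag_diff_scale by (simp add: mult.assoc distrib_left)
qed

lemma B_diff_left:
  assumes "u \<in> X" "v \<in> X" "w \<in> X"
  shows "B (\<lambda>x. u x - v x) w = B u w - B v w"
  using B_add_left[OF assms(1) X_scale[OF assms(2), of "- 1"] assms(3)] B_scale_left[of "- 1" v w] by simp

lemma B_add_right: "u \<in> X \<Longrightarrow> v \<in> X \<Longrightarrow> w \<in> X \<Longrightarrow> B w (\<lambda>x. u x + v x) = B w u + B w v"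
  using B_add_left[of u v w] by (simp add: B_commute[of w])

lemma B_scale_right: "B w (\<lambda>x. c * u x) = c * B w u"
  using B_scale_left[of c u w] by (simp add: B_commute[of w])

lemma B_diff_right: "u \<in> X \<Longrightarrow> v \<in> X \<Longrightarrow> w \<in> X \<Longrightarrow> B w (\<lambda>x. u x - v x) = B w u - B w v"
  using B_diff_left[of u v w] by (simp add: B_commute[of w])

lemma B_AE_cong:
  assumes [measurable]: "u \<in> borel_measurable borel" "v \<in> borel_measurable borel" "w \<in> borel_measurable borel"
    and eq: "AE x in lborel. u x = v x"
  shows "B u w = B v w"
proof -
  have "(LINT z|(lborel \<Otimes>\<^sub>M lborel). gag_diff s u z * gag_diff s w z) =
      (LINT z|(lborel \<Otimes>\<^sub>M lborel). gag_diff s v z * gag_diff s w z)"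
    using gag_diff_AE_cong[OF eq, of s] by (intro integral_cong_AE) auto
  moreover have "(LINT x|lborel. \<gamma> * (u x * w x)) = (LINT x|lborel. \<gamma> * (v x * w x))"
  proof (rule integral_cong_AE)
    show "AE x in lborel. \<gamma> * (u x * w x) = \<gamma> * (v x * w x)" using eq by eventually_elim simp
  qed measurable
  ultimately show ?thesis unfolding B_eq by simp
qed

lemma sobolev_B: "u \<in> X \<Longrightarrow> (LINT x|lborel. \<bar>u x\<bar> powr p) \<le> S * B u u powr (p / 2)"
  unfolding B_def by (rule sobolev)

lemma nn_integral_powr:
  assumes "u \<in> X"
  shows "(\<integral>\<^sup>+x. ennreal (\<bar>u x\<bar> powr p) \<partial>lborel) \<le> ennreal (S * B u u powr (p / 2))"
  using XD(2)[OF assms] sobolev_B[OF assms] by (subst nn_integral_eq_integral) (auto intro: ennreal_leI)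

text \<open>For \<open>\<gamma> = 0\<close> the Gagliardo form does not see constants, so
  definiteness is drawn from the Sobolev inequality, whose right-hand side is 0 here.\<close>

lemma B_eq_0_imp_AE:
  assumes u: "u \<in> X" and "B u u = 0"
  shows "AE x in lborel. u x = 0"
proof -
  have "(LINT x|lborel. \<bar>u x\<bar> powr p) \<le> 0" using sobolev_B[OF u] assms(2) by simp
  then have "(LINT x|lborel. \<bar>u x\<bar> powr p) = 0" by (intro antisym integral_nonneg_AE) auto
  then show ?thesis using integral_nonneg_eq_0_iff_AE[OF XD(2)[OF u]] by simp
qed

lemma B_sq_diff:
  assumes u: "u \<in> X" and v: "v \<in> X"
  shows "B (\<lambda>x. u x - t * v x) (\<lambda>x. u x - t * v x) = B u u - 2 * t * B u v + t\<^sup>2 * B v v"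
  using u v by (simp add: B_diff_left B_diff_right X_scale X_diff B_scale_left B_scale_right
      B_commute[of v u] power2_eq_square algebra_simps)

lemma B_Cauchy_Schwarz:
  assumes u: "u \<in> X" and v: "v \<in> X"
  shows "\<bar>B u v\<bar> \<le> sqrt (B u u) * sqrt (B v v)"
proof (cases "B v v = 0")
  case True
  have "B u v = B v u" by (rule B_commute)
  also have "\<dots> = B (\<lambda>x. 0) u"
    using XD(1)[OF u] XD(1)[OF v] B_eq_0_imp_AE[OF v True] by (intro B_AE_cong) auto
  also have "\<dots> = 0" using B_scale_left[of 0 "\<lambda>x. 0" u] by simp
  finally show ?thesis using B_nonneg by simp
next
  case False
  then have pos: "B v v > 0" using B_nonneg[of v] by simp
  have "0 \<le> B u u - 2 * (B u v / B v v) * B u v + (B u v / B v v)\<^sup>2 * B v v"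
    unfolding B_sq_diff[OF u v, symmetric] by (rule B_nonneg)
  also have "\<dots> = B u u - (B u v)\<^sup>2 / B v v" using pos by (simp add: power2_eq_square field_simps)
  finally have "(B u v)\<^sup>2 \<le> B u u * B v v" using pos by (simp add: field_simps)
  then have "sqrt ((B u v)\<^sup>2) \<le> sqrt (B u u * B v v)" by (rule real_sqrt_le_mono)
  then show ?thesis by (simp add: real_sqrt_mult)
qed

section \<open>Limits, completeness and Riesz representation\<close>

abbreviation energy_norm :: "(real ^ 'n \<Rightarrow> real) \<Rightarrow> real" where
  "energy_norm u \<equiv> sqrt (B u u)"

text \<open>Fatou is applied to the p-th power, the L2 part and the Gagliardo part separately. Each
  of the last two is bounded by \<open>e\<close>, hence the factor 2; it is harmless because the
  bound is only used with \<open>e\<close> tending to 0.\<close>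

lemma X_limit:
  assumes w: "\<And>n::nat. w n \<in> X" and e: "\<And>n. B (w n) (w n) \<le> e"
    and [measurable]: "v \<in> borel_measurable borel"
    and lim: "AE x in lborel. (\<lambda>n. w n x) \<longlonglongrightarrow> v x"
  shows "v \<in> X" "B v v \<le> 2 * e"
proof -
  note [measurable] = XD(1)[OF w]
  have e0: "0 \<le> e" using e[of 0] B_nonneg[of "w 0"] by simp
  have "(\<integral>\<^sup>+x. ennreal (\<bar>v x\<bar> powr p) \<partial>lborel) \<le> ennreal (S * e powr (p / 2))"
  proof (rule nn_integral_le_of_tendsto)
    show "(\<integral>\<^sup>+x. ennreal (\<bar>w n x\<bar> powr p) \<partial>lborel) \<le> ennreal (S * e powr (p / 2))" for n
      by (rule order_trans[OF nn_integral_powr[OF w]])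
        (use e S p B_nonneg in \<open>auto intro!: ennreal_leI mult_left_mono powr_mono2\<close>)
    show "AE x in lborel. (\<lambda>n. ennreal (\<bar>w n x\<bar> powr p)) \<longlonglongrightarrow> ennreal (\<bar>v x\<bar> powr p)"
      using lim by eventually_elim (use p in \<open>auto intro!: tendsto_ennrealI tendsto_powr' tendsto_rabs\<close>)
  qed measurable
  then have 1: "integrable lborel (\<lambda>x. \<bar>v x\<bar> powr p)"
    using S by (intro integral_le_of_nn_integral_le(1)) auto
  have L2: "(\<integral>\<^sup>+x. ennreal (\<gamma> * (v x)\<^sup>2) \<partial>lborel) \<le> ennreal e"
  proof (rule nn_integral_le_of_tendsto)
    show "(\<integral>\<^sup>+x. ennreal (\<gamma> * (w n x)\<^sup>2) \<partial>lborel) \<le> ennreal e" for n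
      using XD(3)[OF w[of n]] \<gamma> order_trans[OF L2_le_B e, of n]
      by (subst nn_integral_eq_integral) (auto intro!: ennreal_leI)
    show "AE x in lborel. (\<lambda>n. ennreal (\<gamma> * (w n x)\<^sup>2)) \<longlonglongrightarrow> ennreal (\<gamma> * (v x)\<^sup>2)"
      using lim by eventually_elim (auto intro!: tendsto_ennrealI tendsto_intros)
  qed measurable
  have 2: "integrable lborel (\<lambda>x. \<gamma> * (v x)\<^sup>2)" "(LINT x|lborel. \<gamma> * (v x)\<^sup>2) \<le> e"
    by (rule integral_le_of_nn_integral_le[OF _ _ e0 L2]; use \<gamma> in simp)+
  have "(\<integral>\<^sup>+z. ennreal ((gag_diff s v z)\<^sup>2) \<partial>(lborel \<Otimes>\<^sub>M lborel)) \<le> ennreal e"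
  proof (rule nn_integral_le_of_tendsto)
    show "(\<integral>\<^sup>+z. ennreal ((gag_diff s (w n) z)\<^sup>2) \<partial>(lborel \<Otimes>\<^sub>M lborel)) \<le> ennreal e" for n
      unfolding nn_integral_gag_diff[OF XD(4)[OF w]]
      by (rule ennreal_leI) (rule order_trans[OF Hdot_inner_le_B e])
    show "AE z in lborel \<Otimes>\<^sub>M lborel. (\<lambda>n. ennreal ((gag_diff s (w n) z)\<^sup>2)) \<longlonglongrightarrow> ennreal ((gag_diff s v z)\<^sup>2)"
      using AE_pair_fst_snd[OF lim]
    proof eventually_elim
      case (elim z)
      then show ?case unfolding gag_diff_def divide_inverse
        by (intro tendsto_ennrealI tendsto_intros) auto
    qed
  qed measurable
  then have 3: "integrable (lborel \<Otimes>\<^sub>M lborel) (\<lambda>z. (gag_diff s v z)\<^sup>2)"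
      "(LINT z|(lborel \<Otimes>\<^sub>M lborel). (gag_diff s v z)\<^sup>2) \<le> e"
    using e0 by (auto intro!: integral_le_of_nn_integral_le)
  show "v \<in> X" using 1 2 3 by (simp add: X_eq finite_gagliardo_eq)
  show "B v v \<le> 2 * e" unfolding B_eq using 2(2) 3(2)
    by (simp only: power2_eq_square[symmetric])
qed

text \<open>Energy norms of differences decay like 4 to the power \<open>- n\<close>. Weighting the
  increments by \<open>2 ^ n\<close> spends half of this decay, and by Sobolev the p-th powers
  \<open>f n\<close> still have summable integrals. Almost everywhere \<open>f n x\<close> therefore
  tends to 0, so the increments are eventually at most \<open>(1/2) ^ n\<close> and the telescoping
  series converges.\<close>

lemma rapidly_Cauchy_AE_convergent:
  assumes u: "\<And>n::nat. u n \<in> X"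
    and cauchy: "\<And>m n. n \<le> m \<Longrightarrow> B (\<lambda>x. u m x - u n x) (\<lambda>x. u m x - u n x) \<le> (1/16) ^ n"
  shows "AE x in lborel. convergent (\<lambda>n. u n x)"
proof -
  note [measurable] = XD(1)[OF u]
  define f where "f n x = (2 ^ n * \<bar>u (Suc n) x - u n x\<bar>) powr p" for n x
  have [measurable]: "f n \<in> borel_measurable borel" for n unfolding f_def by measurable
  have fn: "(\<integral>\<^sup>+x. ennreal (f n x) \<partial>lborel) \<le> ennreal (S * ((1/2) powr p) ^ n)" for n
  proof -
    let ?d = "\<lambda>x. u (Suc n) x - u n x"
    have d: "?d \<in> X" by (intro X_diff u)
    have "(\<integral>\<^sup>+x. ennreal (f n x) \<partial>lborel) = (\<integral>\<^sup>+x. ennreal ((2 ^ n) powr p) * ennreal (\<bar>?d x\<bar> powr p) \<partial>lborel)"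
      by (simp add: f_def powr_mult ennreal_mult')
    also have "\<dots> = ennreal ((2 ^ n) powr p) * (\<integral>\<^sup>+x. ennreal (\<bar>?d x\<bar> powr p) \<partial>lborel)"
      by (rule nn_integral_cmult) measurable
    also have "\<dots> \<le> ennreal ((2 ^ n) powr p) * ennreal (S * ((1/16) ^ n) powr (p / 2))"
      by (intro mult_left_mono order_trans[OF nn_integral_powr[OF d]] ennreal_leI powr_mono2)
        (use S p B_nonneg cauchy in auto)
    also have "\<dots> = ennreal (S * ((2 ^ n) powr p * ((1/16) ^ n) powr (p / 2)))"
      by (simp add: ac_simps flip: ennreal_mult')
    also have "(2 ^ n) powr p * ((1/16) ^ n) powr (p / 2) = ((1/2) powr p) ^ n"
    proof -
      have "(1/16 :: real) ^ n = ((1/4) ^ n) powr 2"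
        by (simp add: power2_eq_square flip: power_mult_distrib)
      then have "((1/16::real) ^ n) powr (p / 2) = ((1/4) ^ n) powr p"
        by (simp only: powr_powr) simp
      then have "(2 ^ n) powr p * ((1/16) ^ n) powr (p / 2) = ((1/2) ^ n :: real) powr p"
        by (simp flip: powr_mult power_mult_distrib)
      also have "\<dots> = ((1/2) powr real n) powr p" by (subst powr_realpow) simp_all
      also have "\<dots> = ((1/2) powr p) ^ n" by (simp add: powr_powr powr_power)
      finally show ?thesis .
    qed
    finally show ?thesis .
  qed
  have "(\<integral>\<^sup>+x. (\<Sum>n. ennreal (f n x)) \<partial>lborel) = (\<Sum>n. \<integral>\<^sup>+x. ennreal (f n x) \<partial>lborel)"
    by (rule nn_integral_suminf) measurable
  also have "\<dots> \<le> (\<Sum>n. ennreal (S * ((1/2) powr p) ^ n))"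
    by (intro suminf_le fn) auto
  also have "\<dots> = ennreal (\<Sum>n. S * ((1/2) powr p) ^ n)"
  proof (rule suminf_ennreal2)
    have "(1/2) powr p < (1::real)" using p powr_mono'[of 1 p "1/2"] by simp
    then show "summable (\<lambda>n. S * ((1/2) powr p) ^ n)" by (intro summable_mult summable_geometric) simp
  qed (use S in simp)
  also have "\<dots> < \<infinity>" by simp
  finally have "AE x in lborel. (\<Sum>n. ennreal (f n x)) \<noteq> \<infinity>"
    by (intro nn_integral_noteq_infinite) auto
  then show ?thesis
  proof eventually_elim
    case (elim x)
    then have "summable (\<lambda>n. f n x)" by (intro summable_suminf_not_top) (auto simp: f_def)
    then have "(\<lambda>n. f n x) \<longlonglongrightarrow> 0" by (rule summable_LIMSEQ_zero)
    then have "eventually (\<lambda>n. f n x < 1) sequentially" by (rule order_tendstoD) simp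
    then have "eventually (\<lambda>n. norm (u (Suc n) x - u n x) \<le> (1/2) ^ n) sequentially"
    proof eventually_elim
      case (elim n)
      have "2 ^ n * \<bar>u (Suc n) x - u n x\<bar> \<le> 1"
        using elim p ge_one_powr_ge_zero[of "2 ^ n * \<bar>u (Suc n) x - u n x\<bar>" p] unfolding f_def by linarith
      then show ?case by (simp add: power_divide field_simps)
    qed
    then have "summable (\<lambda>n. u (Suc n) x - u n x)"
      by (rule summable_comparison_test_ev) (rule summable_geometric, simp)
    then have "convergent (\<lambda>n. (\<Sum>k<n. u (Suc k) x - u k x) + u 0 x)"
      unfolding summable_iff_convergent by (intro convergent_add convergent_const)
    then show ?case by (simp add: sum_lessThan_telescope[of "\<lambda>k. u k x"])
  qed
qed

lemma X_complete:
  assumes u: "\<And>n::nat. u n \<in> X"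
    and cauchy: "\<And>m n. n \<le> m \<Longrightarrow> B (\<lambda>x. u m x - u n x) (\<lambda>x. u m x - u n x) \<le> (1/16) ^ n"
  obtains v where "v \<in> X" "\<And>n. B (\<lambda>x. v x - u n x) (\<lambda>x. v x - u n x) \<le> 2 * (1/16) ^ n"
proof -
  note [measurable] = XD(1)[OF u]
  define v where "v x = lim (\<lambda>n. u n x)" for x
  have [measurable]: "v \<in> borel_measurable borel"
    unfolding v_def by (rule borel_measurable_lim_metric) measurable
  have lim: "AE x in lborel. (\<lambda>n. u n x) \<longlonglongrightarrow> v x"
    using rapidly_Cauchy_AE_convergent[of u] u cauchy by (simp add: v_def convergent_LIMSEQ_iff)
  \<comment> \<open>\<open>X_limit\<close> is applied to the tail \<open>u (k + n) - u n\<close> as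
    \<open>k\<close> grows, whose energies are all at most \<open>(1/16) ^ n\<close>.\<close>
  have *: "(\<lambda>x. v x - u n x) \<in> X \<and> B (\<lambda>x. v x - u n x) (\<lambda>x. v x - u n x) \<le> 2 * (1/16) ^ n" for n
  proof -
    have "AE x in lborel. (\<lambda>k. u (k + n) x - u n x) \<longlonglongrightarrow> v x - u n x"
      using lim by eventually_elim (intro tendsto_intros LIMSEQ_ignore_initial_segment)
    then show ?thesis
      using X_limit[of "\<lambda>k x. u (k + n) x - u n x" "(1/16) ^ n" "\<lambda>x. v x - u n x"] X_diff[OF u u] cauchy
      by simp
  qed
  have "(\<lambda>x. (v x - u 0 x) + u 0 x) \<in> X" using * u by (intro X_add) auto
  then have "v \<in> X" by simp
  then show thesis using that * by blast
qed

lemma dual_spaceD: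
  assumes "L \<in> dual_space X energy_norm"
  shows "\<And>\<phi> \<psi>. \<phi> \<in> X \<Longrightarrow> \<psi> \<in> X \<Longrightarrow> L (\<lambda>x. \<phi> x + \<psi> x) = L \<phi> + L \<psi>"
    "\<And>c \<phi>. \<phi> \<in> X \<Longrightarrow> L (\<lambda>x. c * \<phi> x) = c * L \<phi>"
    "\<exists>C. \<forall>\<phi>\<in>X. \<bar>L \<phi>\<bar> \<le> C * energy_norm \<phi>"
  using assms by (auto simp: dual_space_def)

lemma B_tendsto_left:
  assumes u: "\<And>n::nat. u n \<in> X" and v: "v \<in> X" and \<phi>: "\<phi> \<in> X"
    and lim: "(\<lambda>n. B (\<lambda>x. v x - u n x) (\<lambda>x. v x - u n x)) \<longlonglongrightarrow> 0"
  shows "(\<lambda>n. B (u n) \<phi>) \<longlonglongrightarrow> B v \<phi>"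
proof -
  have "(\<lambda>n. B v \<phi> - B (u n) \<phi>) \<longlonglongrightarrow> 0"
  proof (rule Lim_null_comparison)
    show "\<forall>\<^sub>F n in sequentially. norm (B v \<phi> - B (u n) \<phi>) \<le>
        sqrt (B (\<lambda>x. v x - u n x) (\<lambda>x. v x - u n x)) * energy_norm \<phi>"
      using B_Cauchy_Schwarz[OF X_diff[OF v u] \<phi>] by (simp add: B_diff_left u v \<phi>)
    show "(\<lambda>n. sqrt (B (\<lambda>x. v x - u n x) (\<lambda>x. v x - u n x)) * energy_norm \<phi>) \<longlonglongrightarrow> 0"
      using tendsto_mult_left_zero[OF tendsto_real_sqrt[OF lim, simplified], of "energy_norm \<phi>"] .
  qed
  then show ?thesis using tendsto_diff[OF tendsto_const[of "B v \<phi>"]] by fastforce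
qed

text \<open>The direct method: a minimizing sequence of the quadratic functional \<open>J\<close> is
  Cauchy by the parallelogram identity, and the vanishing first variation at its limit is the
  required equation.\<close>

theorem riesz_representation:
  assumes L: "L \<in> dual_space X energy_norm"
  obtains u where "u \<in> X" "\<And>\<phi>. \<phi> \<in> X \<Longrightarrow> B u \<phi> = L \<phi>"
proof -
  note L_add = dual_spaceD(1)[OF L] and L_scale = dual_spaceD(2)[OF L]
  define J where "J u = B u u / 2 - L u" for u
  obtain C where C: "\<And>\<phi>. \<phi> \<in> X \<Longrightarrow> \<bar>L \<phi>\<bar> \<le> C * energy_norm \<phi>" using dual_spaceD(3)[OF L] by blast
  \<comment> \<open>Completing the square in \<open>energy_norm u\<close>.\<close>
  have J_lower: "- C\<^sup>2 / 2 \<le> J u" if "u \<in> X" for u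
  proof -
    have "0 \<le> (energy_norm u - C)\<^sup>2" by simp
    also have "\<dots> = B u u - 2 * (C * energy_norm u) + C\<^sup>2"
      using B_nonneg[of u] by (simp add: power2_diff)
    also have "\<dots> \<le> B u u - 2 * L u + C\<^sup>2" using C[OF that] by simp
    finally show ?thesis by (simp add: J_def)
  qed
  have bdd: "bdd_below (J ` X)" using J_lower by (auto intro!: bdd_belowI)
  define I where "I = Inf (J ` X)"
  have I: "I \<le> J u" if "u \<in> X" for u unfolding I_def using bdd that by (intro cInf_lower) auto
  \<comment> \<open>The gap is chosen so that \<open>8 * \<delta> n\<close> is exactly the rate
    \<open>(1/16) ^ n\<close> demanded by \<open>X_complete\<close>.\<close>
  define \<delta> :: "nat \<Rightarrow> real" where "\<delta> n = (1/16) ^ n / 8" for n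
  have "\<exists>u\<in>X. J u < I + \<delta> n" for n
    using cInf_lessD[of "J ` X" "I + \<delta> n"] X_zero by (auto simp: I_def \<delta>_def)
  then obtain u where u: "\<And>n. u n \<in> X" and Ju: "\<And>n. J (u n) < I + \<delta> n" by metis
  \<comment> \<open>The linear parts of \<open>J\<close> cancel in the identity for the midpoint,
    and the midpoint value is at least \<open>I\<close>.\<close>
  have parallelogram: "B (\<lambda>x. a x - b x) (\<lambda>x. a x - b x) \<le> 4 * (J a - I) + 4 * (J b - I)"
    if a: "a \<in> X" and b: "b \<in> X" for a b
  proof -
    have w: "(\<lambda>x. (1/2) * (a x + b x)) \<in> X" by (intro X_scale X_add a b)
    have "B (\<lambda>x. a x - b x) (\<lambda>x. a x - b x) = 4 * J a + 4 * J b - 8 * J (\<lambda>x. (1/2) * (a x + b x))"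
      unfolding J_def B_scale_left B_scale_right L_scale[OF X_add[OF a b]]
      using a b by (simp add: L_add B_diff_left B_diff_right B_add_left B_add_right X_add X_diff B_commute[of b a])
        (simp add: field_simps)
    with I[OF w] show ?thesis by simp
  qed
  have "B (\<lambda>x. u m x - u n x) (\<lambda>x. u m x - u n x) \<le> (1/16) ^ n" if "n \<le> m" for m n
  proof -
    have "\<delta> m \<le> \<delta> n" using that by (simp add: \<delta>_def power_decreasing)
    then have "4 * (J (u m) - I) + 4 * (J (u n) - I) \<le> 8 * \<delta> n"
      using Ju[of m] Ju[of n] by simp
    also have "8 * \<delta> n = (1/16) ^ n" by (simp add: \<delta>_def)
    finally show ?thesis using parallelogram[OF u[of m] u[of n]] by linarith
  qed
  then obtain v where v: "v \<in> X" and conv: "\<And>n. B (\<lambda>x. v x - u n x) (\<lambda>x. v x - u n x) \<le> 2 * (1/16) ^ n"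
    using X_complete[of u] u by blast
  have pow: "(\<lambda>n. c * (1/16::real) ^ n) \<longlonglongrightarrow> 0" for c
    by (intro tendsto_mult_right_zero LIMSEQ_realpow_zero) auto
  have lim: "(\<lambda>n. B (\<lambda>x. v x - u n x) (\<lambda>x. v x - u n x)) \<longlonglongrightarrow> 0"
    by (rule tendsto_sandwich[OF _ _ tendsto_const pow[of 2]]) (use conv B_nonneg in auto)
  have "B v \<phi> = L \<phi>" if \<phi>: "\<phi> \<in> X" for \<phi>
  proof -
    define g where "g = B v \<phi> - L \<phi>"
    \<comment> \<open>The variation is taken at the approximants:
      \<open>J (u n + t * \<phi>)\<close> is at least \<open>I\<close>, while \<open>J (u n)\<close>
      exceeds \<open>I\<close> by less than \<open>\<delta> n\<close>. Only then does
      \<open>n\<close> tend to infinity.\<close>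
    have ineq: "0 \<le> t * g + t\<^sup>2 / 2 * B \<phi> \<phi>" for t
    proof (rule LIMSEQ_le_const)
      show "(\<lambda>n. t * (B (u n) \<phi> - L \<phi>) + t\<^sup>2 / 2 * B \<phi> \<phi> + (1/8) * (1/16) ^ n) \<longlonglongrightarrow> t * g + t\<^sup>2 / 2 * B \<phi> \<phi>"
        unfolding g_def by (rule tendsto_eq_intros B_tendsto_left[OF u v \<phi> lim] pow refl)+ simp
      have "0 \<le> t * (B (u n) \<phi> - L \<phi>) + t\<^sup>2 / 2 * B \<phi> \<phi> + (1/8) * (1/16) ^ n" for n
      proof -
        have t\<phi>: "(\<lambda>x. t * \<phi> x) \<in> X" by (rule X_scale[OF \<phi>])
        have "I \<le> J (\<lambda>x. u n x + t * \<phi> x)" by (intro I X_add u t\<phi>)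
        also have "\<dots> = J (u n) + t * (B (u n) \<phi> - L \<phi>) + t\<^sup>2 / 2 * B \<phi> \<phi>"
          unfolding J_def L_add[OF u t\<phi>] L_scale[OF \<phi>]
          using u[of n] t\<phi> \<phi> by (simp add: B_add_left B_add_right X_add B_scale_left B_scale_right
              B_commute[of \<phi> "u n"] power2_eq_square algebra_simps)
        finally show ?thesis using Ju[of n] by (simp add: \<delta>_def)
      qed
      then show "\<exists>N. \<forall>n\<ge>N. 0 \<le> t * (B (u n) \<phi> - L \<phi>) + t\<^sup>2 / 2 * B \<phi> \<phi> + (1/8) * (1/16) ^ n" by blast
    qed
    \<comment> \<open>The choice \<open>t = - (g / b)\<close> nearly minimizes the quadratic in
      \<open>t\<close>; adding 1 keeps the denominator positive when \<open>\<phi>\<close> has zero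
      energy.\<close>
    define b where "b = B \<phi> \<phi> + 1"
    have b: "b > 0" using B_nonneg[of \<phi>] by (simp add: b_def)
    have "0 \<le> - (g / b) * g + (- (g / b))\<^sup>2 / 2 * B \<phi> \<phi>" by (rule ineq)
    also have "\<dots> \<le> - (g / b) * g + (- (g / b))\<^sup>2 / 2 * b"
      by (intro add_left_mono mult_left_mono) (auto simp: b_def)
    also have "\<dots> = - (g\<^sup>2 / (2 * b))" using b by (simp add: power2_eq_square field_simps)
    finally have "g = 0" using b by (simp add: divide_le_0_iff)
    then show ?thesis by (simp add: g_def)
  qed
  then show thesis using that v by blast
qed

end

subsection \<open>Maximum principles\<close>

lemma nn_integral_lborel_translate:
  fixes h :: "'a::euclidean_space"
  assumes [measurable]: "f \<in> borel_measurable borel"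
  shows "(\<integral>\<^sup>+x. f (x + h) \<partial>lborel) = (\<integral>\<^sup>+x. f x \<partial>lborel)"
proof -
  have "(\<integral>\<^sup>+x. f x \<partial>lborel) = (\<integral>\<^sup>+x. f x \<partial>distr lborel borel ((+) h))"
    by (simp add: lborel_distr_plus)
  also have "\<dots> = (\<integral>\<^sup>+x. f (h + x) \<partial>lborel)" by (rule nn_integral_distr) measurable
  finally show ?thesis by (simp add: add.commute)
qed

lemma integrable_lborel_translate:
  fixes h :: "'a::euclidean_space" and f :: "'a \<Rightarrow> real"
  assumes "integrable lborel f"
  shows "integrable lborel (\<lambda>x. f (x + h))"
proof -
  have [measurable]: "f \<in> borel_measurable borel" using assms by auto
  have "(\<integral>\<^sup>+x. ennreal (norm (f (x + h))) \<partial>lborel) = (\<integral>\<^sup>+x. ennreal (norm (f x)) \<partial>lborel)"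
    by (rule nn_integral_lborel_translate[of "\<lambda>x. ennreal (norm (f x))"]) measurable
  then show ?thesis using assms by (simp add: integrable_iff_bounded)
qed

context fractional_energy
begin

text \<open>The kernel depends on \<open>x - y\<close> only, so shifting both variables by
  \<open>h\<close> is a translation of the product space, where \<open>lborel_prod\<close>
  identifies the product measure with Lebesgue measure on pairs.\<close>

lemma X_translate:
  assumes u: "u \<in> X"
  shows "(\<lambda>x. u (x + h)) \<in> X"
proof -
  note [measurable] = XD(1)[OF u]
  have "integrable lborel (\<lambda>z. (gag_diff s u (z + (h, h)))\<^sup>2)"
    using XD(5)[OF u] by (intro integrable_lborel_translate[of "\<lambda>z. (gag_diff s u z)\<^sup>2"]) (simp add: lborel_prod)
  then have "finite_gagliardo s (\<lambda>x. u (x + h))"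
    by (simp add: finite_gagliardo_eq lborel_prod gag_diff_def)
  then show ?thesis
    using integrable_lborel_translate[OF XD(2)[OF u], of h] integrable_lborel_translate[OF XD(3)[OF u], of h]
    by (simp add: X_eq)
qed

text \<open>For disjoint supports the numerator is \<open>- (m x * h y + m y * h x)\<close> and the
  L2 part vanishes. The second claim keeps one of the two symmetric terms; this interaction at a
  distance drives the strong maximum principle.\<close>

lemma B_disjoint:
  assumes m: "m \<in> X" and h: "h \<in> X" and m0: "\<And>x. 0 \<le> m x" and h0: "\<And>x. 0 \<le> h x"
    and mh: "\<And>x. m x * h x = 0"
  shows "B m h \<le> 0"
    "(\<integral>\<^sup>+z. ennreal (m (fst z) * h (snd z) / norm (fst z - snd z) powr (real CARD('n) + 2 * s))
        \<partial>(lborel \<Otimes>\<^sub>M lborel)) \<le> ennreal (- B m h)"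
proof -
  define f where "f z = m (fst z) * h (snd z) / norm (fst z - snd z) powr (real CARD('n) + 2 * s)" for z
  have f0: "0 \<le> f z" for z using m0 h0 by (simp add: f_def)
  have fle: "f z \<le> - (gag_diff s m z * gag_diff s h z)" for z
  proof -
    have "- ((m (fst z) - m (snd z)) * (h (fst z) - h (snd z))) =
        m (fst z) * h (snd z) + m (snd z) * h (fst z)"
      using mh[of "fst z"] mh[of "snd z"] by (auto simp: algebra_simps)
    moreover have "m (fst z) * h (snd z) \<le> m (fst z) * h (snd z) + m (snd z) * h (fst z)"
      using m0 h0 by simp
    ultimately show ?thesis
      unfolding f_def gag_diff_mult minus_divide_left by (intro divide_right_mono) auto
  qed
  have B: "- B m h = (LINT z|(lborel \<Otimes>\<^sub>M lborel). - (gag_diff s m z * gag_diff s h z))"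
    unfolding B_eq mh by simp
  have nonneg: "0 \<le> - (gag_diff s m z * gag_diff s h z)" for z using f0 fle order_trans by blast
  have "0 \<le> - B m h" unfolding B using nonneg by (intro integral_nonneg_AE AE_I2)
  then show "B m h \<le> 0" by simp
  have "(\<integral>\<^sup>+z. ennreal (f z) \<partial>(lborel \<Otimes>\<^sub>M lborel)) \<le>
      (\<integral>\<^sup>+z. ennreal (- (gag_diff s m z * gag_diff s h z)) \<partial>(lborel \<Otimes>\<^sub>M lborel))"
    by (intro nn_integral_mono ennreal_leI fle)
  also have "\<dots> = ennreal (- B m h)" unfolding B
    using integrable_gag_diff_mult[OF m h] nonneg by (intro nn_integral_eq_integral) auto
  finally show "(\<integral>\<^sup>+z. ennreal (m (fst z) * h (snd z) / norm (fst z - snd z) powr (real CARD('n) + 2 * s))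
        \<partial>(lborel \<Otimes>\<^sub>M lborel)) \<le> ennreal (- B m h)" unfolding f_def .
qed

text \<open>Testing with the negative part \<open>n\<close> gives
  \<open>0 \<le> B m n - B n n \<le> - B n n\<close>, so \<open>n\<close> has zero energy.\<close>

lemma weak_maximum_principle:
  assumes w: "w \<in> X" and super: "\<And>\<phi>. \<phi> \<in> X \<Longrightarrow> (\<And>x. 0 \<le> \<phi> x) \<Longrightarrow> 0 \<le> B w \<phi>"
  shows "AE x in lborel. 0 \<le> w x"
proof -
  define m n where "m x = max 0 (w x)" and "n x = max 0 (- 1 * w x)" for x
  have m: "m \<in> X" and n: "n \<in> X" unfolding m_def n_def by (intro X_pos_part X_scale w)+
  have "w = (\<lambda>x. m x - n x)" by (auto simp: m_def n_def fun_eq_iff max_def)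
  then have "B w n = B m n - B n n" using B_diff_left[OF m n n] by simp
  moreover have "B m n \<le> 0" by (rule B_disjoint(1)[OF m n]) (auto simp: m_def n_def max_def)
  moreover have "0 \<le> B w n" using n by (rule super) (simp add: n_def)
  ultimately have "B n n = 0" using B_nonneg[of n] by simp
  then have "AE x in lborel. n x = 0" by (rule B_eq_0_imp_AE[OF n])
  then show ?thesis by eventually_elim (auto simp: n_def max_def split: if_splits)
qed

text \<open>
  With \<open>h = max 0 (\<eta> - w / \<epsilon>)\<close> and \<open>m = max 0 (w - \<epsilon> * \<eta>)\<close> one has \<open>w = m + \<epsilon> * \<eta> - \<epsilon> * h\<close> and \<open>m * h = 0\<close>.
  Testing with \<open>h\<close> gives \<open>- B m h \<le> \<epsilon> * B \<eta> \<eta>\<close>, where \<open>- B m h\<close> dominates the integral of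
  \<open>m x * h y\<close> against the kernel. As \<open>\<epsilon>\<close> tends to \<open>0\<close>, \<open>w x * \<eta> y = 0\<close> for almost all \<open>x\<close> and
  almost all \<open>y\<close> with \<open>w y = 0\<close>.
\<close>

lemma supersolution_zero_set:
  assumes w: "w \<in> X" and w0: "\<And>x. 0 \<le> w x" and \<eta>: "\<eta> \<in> X" and \<eta>0: "\<And>x. 0 \<le> \<eta> x"
    and super: "\<And>\<phi>. \<phi> \<in> X \<Longrightarrow> (\<And>x. 0 \<le> \<phi> x) \<Longrightarrow> 0 \<le> B w \<phi>"
    and nontrivial: "\<not> (AE x in lborel. w x = 0)"
  shows "(\<integral>\<^sup>+x. ennreal (\<eta> x) * indicator {x. w x = 0} x \<partial>lborel) = 0"
proof -
  note [measurable] = XD(1)[OF w] XD(1)[OF \<eta>]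
  define \<epsilon> where "\<epsilon> n = 1 / real (Suc n)" for n
  have \<epsilon>: "0 < \<epsilon> n" for n by (simp add: \<epsilon>_def)
  have \<epsilon>0: "\<epsilon> \<longlonglongrightarrow> 0" unfolding \<epsilon>_def by (rule LIMSEQ_Suc[OF lim_1_over_n])
  define h where "h n x = max 0 (\<eta> x - (1 / \<epsilon> n) * w x)" for n x
  define m where "m n x = max 0 (w x - \<epsilon> n * \<eta> x)" for n x
  have h: "h n \<in> X" for n unfolding h_def by (intro X_pos_part X_diff X_scale w \<eta>)
  have m: "m n \<in> X" for n unfolding m_def by (intro X_pos_part X_diff X_scale w \<eta>)
  have hx: "\<epsilon> n * h n x = max 0 (\<epsilon> n * \<eta> x - w x)" for n x
    using \<epsilon>[of n] by (simp add: h_def max_mult_distrib_left right_diff_distrib)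
  have mh: "m n x * h n x = 0" for n x
    using hx[of n x] \<epsilon>[of n] by (cases "w x \<le> \<epsilon> n * \<eta> x") (auto simp: m_def max_def)
  have m0: "0 \<le> m n x" and h0: "0 \<le> h n x" for n x by (simp_all add: m_def h_def)
  define K where "K z = norm (fst z - snd z) powr (real CARD('n) + 2 * s)" for z :: "(real ^ 'n) \<times> (real ^ 'n)"
  have [measurable]: "K \<in> borel_measurable (lborel \<Otimes>\<^sub>M lborel)" unfolding K_def by measurable
  have Bmh: "- B (m n) (h n) \<le> \<epsilon> n * B \<eta> \<eta>" for n
  proof -
    define z where "z x = \<epsilon> n * \<eta> x - \<epsilon> n * h n x" for x
    have z: "z \<in> X" unfolding z_def by (intro X_diff X_scale \<eta> h)
    have "w = (\<lambda>x. m n x + z x)"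
    proof
      fix x show "w x = m n x + z x" unfolding z_def hx m_def by (simp add: max_def)
    qed
    then have "B w (h n) = B (m n) (h n) + B z (h n)" using B_add_left[OF m z h] by simp
    also have "B z (h n) = \<epsilon> n * B \<eta> (h n) - \<epsilon> n * B (h n) (h n)"
      unfolding z_def using \<eta> h by (simp add: B_diff_left X_scale B_scale_left)
    finally have "- B (m n) (h n) \<le> \<epsilon> n * (B \<eta> (h n) - B (h n) (h n))"
      using super[OF h h0, of n] by (simp add: right_diff_distrib)
    also have "\<dots> \<le> \<epsilon> n * B \<eta> \<eta>"
    proof (rule mult_left_mono)
      \<comment> \<open>Nonnegativity of the energy of \<open>\<eta> - h n\<close> bounds
        \<open>B \<eta> (h n)\<close> by half of
        \<open>B \<eta> \<eta> + B (h n) (h n)\<close>.\<close>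
      show "B \<eta> (h n) - B (h n) (h n) \<le> B \<eta> \<eta>"
        using B_nonneg[of "\<lambda>x. \<eta> x - 1 * h n x"] B_nonneg[of \<eta>] B_nonneg[of "h n"]
        unfolding B_sq_diff[OF \<eta> h] by simp
    qed (use \<epsilon>[of n] in simp)
    finally show ?thesis .
  qed
  \<comment> \<open>Where \<open>w\<close> vanishes, \<open>h n\<close> equals \<open>\<eta>\<close>
    for every \<open>n\<close>. Restricting the second variable to that set leaves
    \<open>m n\<close> as the only factor that varies with \<open>n\<close>.\<close>
  define F where "F z = w (fst z) * (\<eta> (snd z) * indicator {x. w x = 0} (snd z))" for z
  have "(\<integral>\<^sup>+z. ennreal (F z / K z) \<partial>(lborel \<Otimes>\<^sub>M lborel)) \<le> ennreal (\<epsilon> k * B \<eta> \<eta>)" for k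
  proof (rule nn_integral_le_of_tendsto)
    \<comment> \<open>Along the shifted index \<open>n + k\<close> all integrals are at most
      \<open>\<epsilon> k * B \<eta> \<eta>\<close>. The limit integral inherits this bound for
      every \<open>k\<close>, hence it is 0.\<close>
    define f where "f n z = m n (fst z) * (\<eta> (snd z) * indicator {x. w x = 0} (snd z)) / K z" for n z
    have [measurable]: "m n \<in> borel_measurable borel" for n by (rule XD(1)[OF m])
    show "(\<lambda>z. ennreal (f (n + k) z)) \<in> borel_measurable (lborel \<Otimes>\<^sub>M lborel)" for n
      unfolding f_def by measurable
    show "(\<integral>\<^sup>+z. ennreal (f (n + k) z) \<partial>(lborel \<Otimes>\<^sub>M lborel)) \<le> ennreal (\<epsilon> k * B \<eta> \<eta>)" for n
    proof -
      have "f (n + k) z \<le> m (n + k) (fst z) * h (n + k) (snd z) / K z" for z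
        unfolding f_def
        by (intro divide_right_mono mult_left_mono m0) (auto simp: indicator_def h_def K_def \<eta>0)
      then have "(\<integral>\<^sup>+z. ennreal (f (n + k) z) \<partial>(lborel \<Otimes>\<^sub>M lborel)) \<le>
          (\<integral>\<^sup>+z. ennreal (m (n + k) (fst z) * h (n + k) (snd z) / K z) \<partial>(lborel \<Otimes>\<^sub>M lborel))"
        by (intro nn_integral_mono ennreal_leI)
      also have "\<dots> \<le> ennreal (- B (m (n + k)) (h (n + k)))"
        unfolding K_def by (rule B_disjoint(2)[OF m h m0 h0 mh])
      also have "\<dots> \<le> ennreal (\<epsilon> k * B \<eta> \<eta>)"
      proof (rule ennreal_leI)
        have "\<epsilon> (n + k) \<le> \<epsilon> k" by (simp add: \<epsilon>_def frac_le)
        then have "\<epsilon> (n + k) * B \<eta> \<eta> \<le> \<epsilon> k * B \<eta> \<eta>" by (intro mult_right_mono B_nonneg)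
        then show "- B (m (n + k)) (h (n + k)) \<le> \<epsilon> k * B \<eta> \<eta>" using Bmh order_trans by blast
      qed
      finally show ?thesis .
    qed
    have "(\<lambda>n. m n x) \<longlonglongrightarrow> w x" for x
    proof -
      have "(\<lambda>n. max 0 (w x - \<epsilon> n * \<eta> x)) \<longlonglongrightarrow> max 0 (w x - 0 * \<eta> x)"
        by (intro tendsto_max tendsto_intros \<epsilon>0)
      then show ?thesis using w0[of x] by (simp add: m_def max_def)
    qed
    then have "(\<lambda>n. ennreal (f (n + k) z)) \<longlonglongrightarrow> ennreal (F z / K z)" for z
      unfolding f_def F_def divide_inverse by (intro tendsto_ennrealI tendsto_intros LIMSEQ_ignore_initial_segment)
    then show "AE z in lborel \<Otimes>\<^sub>M lborel. (\<lambda>n. ennreal (f (n + k) z)) \<longlonglongrightarrow> ennreal (F z / K z)"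
      by simp
  qed
  moreover have "(\<lambda>k. ennreal (\<epsilon> k * B \<eta> \<eta>)) \<longlonglongrightarrow> ennreal 0"
    using tendsto_mult_left_zero[OF \<epsilon>0] by (intro tendsto_ennrealI)
  ultimately have "(\<integral>\<^sup>+z. ennreal (F z / K z) \<partial>(lborel \<Otimes>\<^sub>M lborel)) \<le> ennreal 0"
    by (intro LIMSEQ_le_const) auto
  moreover have [measurable]: "F \<in> borel_measurable (lborel \<Otimes>\<^sub>M lborel)" unfolding F_def by measurable
  ultimately have "AE z in lborel \<Otimes>\<^sub>M lborel. ennreal (F z / K z) = 0"
    by (subst (asm) ennreal_0, subst nn_integral_0_iff_AE[symmetric]) auto
  \<comment> \<open>Off the diagonal the kernel is positive and can be cancelled. On the diagonal
    \<open>F\<close> is 0, since one factor is \<open>w\<close> and another is the indicator of its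
    zero set at the same point.\<close>
  then have "AE z in lborel \<Otimes>\<^sub>M lborel. ennreal (F z) = 0"
  proof eventually_elim
    case (elim z)
    show ?case
    proof (cases "fst z = snd z")
      case True
      then show ?thesis by (cases "w (snd z) = 0") (auto simp: F_def)
    next
      case False
      then have "K z > 0" by (simp add: K_def)
      then show ?thesis using elim by (simp add: ennreal_eq_0_iff divide_le_0_iff)
    qed
  qed
  then have "0 = (\<integral>\<^sup>+z. ennreal (F z) \<partial>(lborel \<Otimes>\<^sub>M lborel))"
    by (simp add: nn_integral_0_iff_AE)
  \<comment> \<open>\<open>F\<close> is a product of a function of \<open>x\<close> and a function
    of \<open>y\<close>, so Tonelli splits the integral into two factors, one of which must be
    0.\<close>
  also have "\<dots> = (\<integral>\<^sup>+x. \<integral>\<^sup>+y. ennreal (F (x, y)) \<partial>lborel \<partial>lborel)"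
    by (rule lborel.nn_integral_fst[symmetric]) measurable
  also have "\<dots> = (\<integral>\<^sup>+x. \<integral>\<^sup>+y. ennreal (w x) * (ennreal (\<eta> y) * indicator {x. w x = 0} y) \<partial>lborel \<partial>lborel)"
    by (intro nn_integral_cong) (use w0 \<eta>0 in \<open>auto simp: F_def indicator_def ennreal_mult'\<close>)
  also have "\<dots> = (\<integral>\<^sup>+x. ennreal (w x) * (\<integral>\<^sup>+y. ennreal (\<eta> y) * indicator {x. w x = 0} y \<partial>lborel) \<partial>lborel)"
    by (intro nn_integral_cong nn_integral_cmult) measurable
  also have "\<dots> = (\<integral>\<^sup>+x. ennreal (w x) \<partial>lborel) * (\<integral>\<^sup>+y. ennreal (\<eta> y) * indicator {x. w x = 0} y \<partial>lborel)"
    by (rule nn_integral_multc) measurable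
  finally have "(\<integral>\<^sup>+x. ennreal (w x) \<partial>lborel) = 0 \<or>
      (\<integral>\<^sup>+y. ennreal (\<eta> y) * indicator {x. w x = 0} y \<partial>lborel) = 0" by simp
  moreover have "(\<integral>\<^sup>+x. ennreal (w x) \<partial>lborel) \<noteq> 0"
  proof
    assume "(\<integral>\<^sup>+x. ennreal (w x) \<partial>lborel) = 0"
    then have "AE x in lborel. ennreal (w x) = 0" by (simp add: nn_integral_0_iff_AE)
    then have "AE x in lborel. w x = 0"
      by eventually_elim (use w0 in \<open>auto simp: ennreal_eq_0_iff intro: antisym\<close>)
    with nontrivial show False by simp
  qed
  ultimately show ?thesis by simp
qed

text \<open>Taking for \<open>\<eta>\<close> all translates of the supersolution itself avoids constructing cutoff functions.\<close>

theorem strong_maximum_principle: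
  assumes w: "w \<in> X" and super: "\<And>\<phi>. \<phi> \<in> X \<Longrightarrow> (\<And>x. 0 \<le> \<phi> x) \<Longrightarrow> 0 \<le> B w \<phi>"
    and nontrivial: "\<not> (AE x in lborel. w x = 0)"
  shows "AE x in lborel. 0 < w x"
proof -
  note [measurable] = XD(1)[OF w]
  have nonneg: "AE x in lborel. 0 \<le> w x" using w super by (rule weak_maximum_principle)
  \<comment> \<open>\<open>supersolution_zero_set\<close> asks for nonnegativity at every point, so
    \<open>w\<close> is exchanged for an almost everywhere equal function.\<close>
  define v where "v x = max 0 (w x)" for x
  have v: "v \<in> X" unfolding v_def by (rule X_pos_part[OF w])
  note [measurable] = XD(1)[OF v]
  have wv: "AE x in lborel. w x = v x" using nonneg by eventually_elim (simp add: v_def)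
  have v0: "0 \<le> v x" for x by (simp add: v_def)
  have super_v: "0 \<le> B v \<phi>" if "\<phi> \<in> X" "\<And>x. 0 \<le> \<phi> x" for \<phi>
    using super[OF that] B_AE_cong[OF XD(1)[OF w] XD(1)[OF v] XD(1)[OF that(1)] wv] by simp
  have nontrivial_v: "\<not> (AE x in lborel. v x = 0)"
  proof
    assume "AE x in lborel. v x = 0"
    with wv have "AE x in lborel. w x = 0" by eventually_elim simp
    with nontrivial show False by simp
  qed
  define Z where "Z = {x. v x = 0}"
  have [measurable]: "Z \<in> sets borel" unfolding Z_def by measurable
  have "(\<integral>\<^sup>+x. ennreal (v (x + h)) * indicator Z x \<partial>lborel) = 0" for h
    unfolding Z_def by (rule supersolution_zero_set[OF v v0 X_translate[OF v] v0 super_v nontrivial_v])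
  \<comment> \<open>Integrating over all shifts \<open>h\<close> and exchanging the order, each
    point of \<open>Z\<close> contributes the full integral of \<open>v\<close>, whence that
    integral times the measure of \<open>Z\<close> is 0. The integral may be infinite, so the
    computation stays in \<open>ennreal\<close>.\<close>
  then have "0 = (\<integral>\<^sup>+h. \<integral>\<^sup>+x. ennreal (v (x + h)) * indicator Z x \<partial>lborel \<partial>lborel)" by simp
  also have "\<dots> = (\<integral>\<^sup>+x. \<integral>\<^sup>+h. ennreal (v (x + h)) * indicator Z x \<partial>lborel \<partial>lborel)"
    by (rule lborel_pair.Fubini') measurable
  also have "\<dots> = (\<integral>\<^sup>+x. (\<integral>\<^sup>+h. ennreal (v (x + h)) \<partial>lborel) * indicator Z x \<partial>lborel)"
    by (intro nn_integral_cong nn_integral_multc) measurable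
  also have "\<dots> = (\<integral>\<^sup>+x. (\<integral>\<^sup>+h. ennreal (v h) \<partial>lborel) * indicator Z x \<partial>lborel)"
    using nn_integral_lborel_translate[of "\<lambda>h. ennreal (v h)"] by (simp add: add.commute)
  also have "\<dots> = (\<integral>\<^sup>+h. ennreal (v h) \<partial>lborel) * emeasure lborel Z"
    by (rule nn_integral_cmult_indicator) simp
  finally have "(\<integral>\<^sup>+h. ennreal (v h) \<partial>lborel) = 0 \<or> emeasure lborel Z = 0" by simp
  moreover have "(\<integral>\<^sup>+h. ennreal (v h) \<partial>lborel) \<noteq> 0"
  proof
    assume "(\<integral>\<^sup>+x. ennreal (v x) \<partial>lborel) = 0"
    then have "AE x in lborel. ennreal (v x) = 0" by (simp add: nn_integral_0_iff_AE)
    then have "AE x in lborel. v x = 0"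
      by eventually_elim (use v0 in \<open>auto simp: ennreal_eq_0_iff intro: antisym\<close>)
    with nontrivial_v show False by simp
  qed
  ultimately have "AE x in lborel. x \<notin> Z" by (intro AE_I[of _ _ Z]) auto
  with wv show ?thesis by eventually_elim (use v0 in \<open>auto simp: Z_def less_le\<close>)
qed

end

subsection \<open>The coupled system\<close>

text \<open>The second equation has the same nonlinearity with exponents and arguments exchanged,
  \<open>nonlin b a v u\<close>, so each estimate covers both equations.\<close>

definition nonlin :: "real \<Rightarrow> real \<Rightarrow> ('a \<Rightarrow> real) \<Rightarrow> ('a \<Rightarrow> real) \<Rightarrow> 'a \<Rightarrow> real" where
  "nonlin a b u v x = \<bar>u x\<bar> powr (a - 2) * u x * \<bar>v x\<bar> powr b"

text \<open>The exponent \<open>a - 2\<close> may be negative; absorbing the factor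
  \<open>u x\<close> leaves \<open>a - 1\<close>, which is positive for \<open>1 < a\<close>, and
  monotonicity and continuity can be read off. At \<open>u x = 0\<close> both sides are 0 because
  \<open>0 powr c = 0\<close>.\<close>

lemma nonlin_nonneg_eq:
  assumes "0 \<le> u x"
  shows "nonlin a b u v x = u x powr (a - 1) * \<bar>v x\<bar> powr b"
proof (cases "u x = 0")
  case False
  then have "u x powr (a - 2) * u x = u x powr (a - 1)"
    using assms powr_add[of "u x" "a - 2" 1] by simp
  then show ?thesis using assms by (simp add: nonlin_def)
qed (simp add: nonlin_def)

lemma abs_nonlin: "\<bar>nonlin a b u v x\<bar> = \<bar>u x\<bar> powr (a - 1) * \<bar>v x\<bar> powr b"
  using nonlin_nonneg_eq[of "\<lambda>x. \<bar>u x\<bar>" x a b v] by (simp add: nonlin_def abs_mult)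

lemma nonlin_nonneg: "0 \<le> u x \<Longrightarrow> 0 \<le> nonlin a b u v x"
  by (simp add: nonlin_def)

lemma nonlin_mono:
  assumes "1 < a" "1 < b" "0 \<le> u x" "u x \<le> u' x" "0 \<le> v x" "v x \<le> v' x"
  shows "nonlin a b u v x \<le> nonlin a b u' v' x"
  using assms by (simp add: nonlin_nonneg_eq mult_mono powr_mono2)

lemma nonlin_tendsto:
  assumes "1 < a" "1 < b" and u: "(\<lambda>n. u n x) \<longlonglongrightarrow> u' x" and v: "(\<lambda>n. v n x) \<longlonglongrightarrow> v' x"
    and nonneg: "\<And>n. 0 \<le> u n x"
  shows "(\<lambda>n. nonlin a b (u n) (v n) x) \<longlonglongrightarrow> nonlin a b u' v' x"
proof -
  have "0 \<le> u' x" using u nonneg by (intro LIMSEQ_le_const) auto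
  then have "(\<lambda>n. u n x powr (a - 1) * \<bar>v n x\<bar> powr b) \<longlonglongrightarrow> nonlin a b u' v' x"
    unfolding nonlin_nonneg_eq[of u', OF \<open>0 \<le> u' x\<close>]
    using assms by (intro tendsto_mult tendsto_powr' tendsto_rabs tendsto_const u v) auto
  then show ?thesis using nonneg by (simp add: nonlin_nonneg_eq)
qed

lemma borel_measurable_nonlin [measurable]:
  assumes [measurable]: "u \<in> borel_measurable M" "v \<in> borel_measurable M"
  shows "nonlin a b u v \<in> borel_measurable M"
  unfolding nonlin_def by measurable

text \<open>All three moduli are replaced by their maximum. The exponents \<open>a - 1\<close>,
  \<open>b\<close> and 1 add up to \<open>a + b\<close>, and the maximum is one of the
  three.\<close>

lemma nonlin_Young:
  assumes "1 < a" "1 < b"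
  shows "\<bar>nonlin a b u v x * c\<bar> \<le> \<bar>u x\<bar> powr (a + b) + \<bar>v x\<bar> powr (a + b) + \<bar>c\<bar> powr (a + b)"
proof -
  define m where "m = max (max \<bar>u x\<bar> \<bar>v x\<bar>) \<bar>c\<bar>"
  have m: "\<bar>u x\<bar> \<le> m" "\<bar>v x\<bar> \<le> m" "\<bar>c\<bar> \<le> m" "0 \<le> m" by (auto simp: m_def)
  have "\<bar>nonlin a b u v x * c\<bar> = \<bar>u x\<bar> powr (a - 1) * \<bar>v x\<bar> powr b * \<bar>c\<bar>"
    by (simp add: abs_mult abs_nonlin)
  also have "\<dots> \<le> m powr (a - 1) * m powr b * m"
    using assms m by (intro mult_mono powr_mono2) auto
  also have "\<dots> = m powr (a - 1) * m powr b * m powr 1" using m by simp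
  also have "\<dots> = m powr (a + b)" by (simp only: powr_add[symmetric]) simp
  also have "\<dots> \<le> \<bar>u x\<bar> powr (a + b) + \<bar>v x\<bar> powr (a + b) + \<bar>c\<bar> powr (a + b)"
    by (auto simp: m_def max_def)
  finally show ?thesis .
qed

section \<open>The nonlinear term as a bounded functional\<close>

context fractional_energy
begin

text \<open>\<open>dual_norm\<close> is a supremum of reals, so boundedness of the set must be shown
  before it bounds anything. A test function of zero energy cannot be normalized and is handled by
  the constant \<open>C\<close>.\<close>

lemma abs_le_dual_norm:
  assumes L: "L \<in> dual_space X energy_norm" and \<phi>: "\<phi> \<in> X"
  shows "\<bar>L \<phi>\<bar> \<le> dual_norm X energy_norm L * energy_norm \<phi>"
proof -
  obtain C where C: "\<And>\<phi>. \<phi> \<in> X \<Longrightarrow> \<bar>L \<phi>\<bar> \<le> C * energy_norm \<phi>" using dual_spaceD(3)[OF L] by blast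
  show ?thesis
  proof (cases "B \<phi> \<phi> = 0")
    case True
    then show ?thesis using C[OF \<phi>] by simp
  next
    case False
    define t where "t = energy_norm \<phi>"
    have t: "t > 0" using False B_nonneg[of \<phi>] by (simp add: t_def)
    define \<psi> where "\<psi> = (\<lambda>x. (1 / t) * \<phi> x)"
    have \<psi>: "\<psi> \<in> X" unfolding \<psi>_def by (rule X_scale[OF \<phi>])
    have "B \<psi> \<psi> = B \<phi> \<phi> / t\<^sup>2"
      unfolding \<psi>_def B_scale_left B_scale_right by (simp add: power2_eq_square)
    also have "\<dots> = 1" using False B_nonneg[of \<phi>] by (simp add: t_def)
    finally have "energy_norm \<psi> \<le> 1" by simp
    then have "\<bar>L \<psi>\<bar> \<le> dual_norm X energy_norm L"
      unfolding dual_norm_def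
    proof (intro cSUP_upper bdd_aboveI2)
      fix \<phi> assume "\<phi> \<in> {\<phi> \<in> X. energy_norm \<phi> \<le> 1}"
      then have \<phi>: "\<phi> \<in> X" "0 \<le> energy_norm \<phi>" "energy_norm \<phi> \<le> 1" using B_nonneg[of \<phi>] by auto
      have "\<bar>L \<phi>\<bar> \<le> C * energy_norm \<phi>" by (rule C[OF \<phi>(1)])
      also have "C * energy_norm \<phi> \<le> \<bar>C\<bar> * 1" using \<phi> by (intro mult_mono) auto
      finally show "\<bar>L \<phi>\<bar> \<le> \<bar>C\<bar>" by simp
    qed (use \<psi> in simp)
    moreover have "\<bar>L \<psi>\<bar> = \<bar>L \<phi>\<bar> / t"
      unfolding \<psi>_def dual_spaceD(2)[OF L \<phi>] using t by (simp add: abs_mult)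
    ultimately show ?thesis using t by (simp add: t_def[symmetric] field_simps)
  qed
qed

lemma integrable_nonlin_mult:
  assumes ab: "1 < a" "1 < b" "a + b = p" and u: "u \<in> X" and v: "v \<in> X" and \<phi>: "\<phi> \<in> X"
  shows "integrable lborel (\<lambda>x. nonlin a b u v x * \<phi> x)"
    "\<bar>LINT x|lborel. nonlin a b u v x * \<phi> x\<bar> \<le>
      S * (B u u powr (p / 2) + B v v powr (p / 2) + B \<phi> \<phi> powr (p / 2))"
proof -
  note [measurable] = XD(1)[OF u] XD(1)[OF v] XD(1)[OF \<phi>]
  have i: "integrable lborel (\<lambda>x. \<bar>u x\<bar> powr p + \<bar>v x\<bar> powr p + \<bar>\<phi> x\<bar> powr p)"
    using XD(2)[OF u] XD(2)[OF v] XD(2)[OF \<phi>] by simp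
  have Y: "\<bar>nonlin a b u v x * \<phi> x\<bar> \<le> \<bar>u x\<bar> powr p + \<bar>v x\<bar> powr p + \<bar>\<phi> x\<bar> powr p" for x
    using nonlin_Young[OF ab(1,2), of u v x "\<phi> x"] ab(3) by simp
  show int: "integrable lborel (\<lambda>x. nonlin a b u v x * \<phi> x)"
    by (rule Bochner_Integration.integrable_bound[OF i])
      (use Y in auto)
  have "\<bar>LINT x|lborel. nonlin a b u v x * \<phi> x\<bar> \<le> (LINT x|lborel. \<bar>nonlin a b u v x * \<phi> x\<bar>)"
    by (rule integral_abs_bound)
  also have "\<dots> \<le> (LINT x|lborel. \<bar>u x\<bar> powr p + \<bar>v x\<bar> powr p + \<bar>\<phi> x\<bar> powr p)"
    by (intro integral_mono integrable_abs int i Y)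
  also have "\<dots> \<le> S * (B u u powr (p / 2) + B v v powr (p / 2) + B \<phi> \<phi> powr (p / 2))"
    using XD(2)[OF u] XD(2)[OF v] XD(2)[OF \<phi>] sobolev_B[OF u] sobolev_B[OF v] sobolev_B[OF \<phi>]
    by (simp add: distrib_left)
  finally show "\<bar>LINT x|lborel. nonlin a b u v x * \<phi> x\<bar> \<le>
      S * (B u u powr (p / 2) + B v v powr (p / 2) + B \<phi> \<phi> powr (p / 2))" .
qed

text \<open>Rescaling \<open>\<phi>\<close> to energy norm \<open>r\<close> turns the Young-type bound above into one linear in \<open>\<phi>\<close>.\<close>

lemma nonlin_functional_bound:
  assumes ab: "1 < a" "1 < b" "a + b = p" and u: "u \<in> X" and v: "v \<in> X" and \<phi>: "\<phi> \<in> X"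
    and r: "0 < r" and Bu: "B u u \<le> r\<^sup>2" and Bv: "B v v \<le> r\<^sup>2"
  shows "\<bar>LINT x|lborel. nonlin a b u v x * \<phi> x\<bar> \<le> 3 * S * r powr (p - 1) * energy_norm \<phi>"
proof (cases "B \<phi> \<phi> = 0")
  case True
  have "AE x in lborel. nonlin a b u v x * \<phi> x = 0"
    using B_eq_0_imp_AE[OF \<phi> True] by eventually_elim simp
  then have "(LINT x|lborel. nonlin a b u v x * \<phi> x) = 0" by (rule integral_eq_zero_AE)
  then show ?thesis using True by simp
next
  case False
  define t where "t = energy_norm \<phi>"
  have t: "t > 0" and t2: "t\<^sup>2 = B \<phi> \<phi>" using False B_nonneg[of \<phi>] by (simp_all add: t_def)
  define w where "w = (\<lambda>x. (r / t) * \<phi> x)"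
  have w: "w \<in> X" unfolding w_def by (rule X_scale[OF \<phi>])
  have "B w w = r\<^sup>2"
    unfolding w_def B_scale_left B_scale_right t2[symmetric] using t by (simp add: power2_eq_square)
  have rp: "(r\<^sup>2) powr (p / 2) = r powr p" using r by (simp add: powr_powr flip: powr_numeral)
  have "(r / t) * \<bar>LINT x|lborel. nonlin a b u v x * \<phi> x\<bar> = \<bar>LINT x|lborel. (r / t) * (nonlin a b u v x * \<phi> x)\<bar>"
    using r t by (simp add: abs_mult)
  also have "\<dots> = \<bar>LINT x|lborel. nonlin a b u v x * w x\<bar>" by (simp add: w_def ac_simps)
  also have "\<dots> \<le> S * (B u u powr (p / 2) + B v v powr (p / 2) + B w w powr (p / 2))"
    by (rule integrable_nonlin_mult(2)[OF ab u v w])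
  also have "\<dots> \<le> S * ((r\<^sup>2) powr (p / 2) + (r\<^sup>2) powr (p / 2) + (r\<^sup>2) powr (p / 2))"
    unfolding \<open>B w w = r\<^sup>2\<close> using S p Bu Bv B_nonneg by (intro mult_left_mono add_mono powr_mono2) auto
  also have "\<dots> = 3 * S * r powr p" by (simp add: rp)
  also have "\<dots> = r * (3 * S * r powr (p - 1))"
    using r powr_add[of r 1 "p - 1"] by (simp add: ac_simps)
  finally have "r * \<bar>LINT x|lborel. nonlin a b u v x * \<phi> x\<bar> \<le> r * (3 * S * r powr (p - 1) * t)"
    using t by (simp add: field_simps)
  then show ?thesis using r by (simp add: t_def)
qed

text \<open>\<open>u\<close> and \<open>v\<close> are frozen data and \<open>w\<close> is the
  unknown of a linear problem. The system itself is the fixed point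
  \<open>solves a b f u v u\<close> together with \<open>solves b a g v u v\<close>.\<close>

definition solves :: "real \<Rightarrow> real \<Rightarrow> ((real ^ 'n \<Rightarrow> real) \<Rightarrow> real) \<Rightarrow>
    (real ^ 'n \<Rightarrow> real) \<Rightarrow> (real ^ 'n \<Rightarrow> real) \<Rightarrow> (real ^ 'n \<Rightarrow> real) \<Rightarrow> bool" where
  "solves a b f u v w \<longleftrightarrow> w \<in> X \<and>
    (\<forall>\<phi>\<in>X. B w \<phi> = a / p * (LINT x|lborel. nonlin a b u v x * \<phi> x) + f \<phi>)"

lemma nonneg_functionalD:
  "nonneg_functional X f \<Longrightarrow> \<phi> \<in> X \<Longrightarrow> (\<And>x. 0 \<le> \<phi> x) \<Longrightarrow> 0 \<le> f \<phi>"
  by (simp add: nonneg_functional_def)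

lemma solves_supersolution:
  assumes ab: "1 < a" "1 < b" "a + b = p" and f: "nonneg_functional X f"
    and u: "AE x in lborel. 0 \<le> u x" and w: "solves a b f u v w"
    and \<phi>: "\<phi> \<in> X" "\<And>x. 0 \<le> \<phi> x"
  shows "0 \<le> B w \<phi>"
proof -
  have "0 \<le> (LINT x|lborel. nonlin a b u v x * \<phi> x)"
    using u by (intro integral_nonneg_AE, eventually_elim) (simp add: nonlin_nonneg \<phi>(2))
  then show ?thesis
    using w ab p nonneg_functionalD[OF f \<phi>] \<phi>(1) by (simp add: solves_def)
qed

lemma solves_nonneg:
  assumes "1 < a" "1 < b" "a + b = p" "nonneg_functional X f"
    and "AE x in lborel. 0 \<le> u x" and "solves a b f u v w"
  shows "AE x in lborel. 0 \<le> w x"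
  using solves_supersolution[OF assms] assms(6) by (intro weak_maximum_principle) (auto simp: solves_def)

lemma solves_exists:
  assumes ab: "1 < a" "1 < b" "a + b = p" and f: "f \<in> dual_space X energy_norm"
    and u: "u \<in> X" and v: "v \<in> X"
  shows "\<exists>w. solves a b f u v w"
proof -
  \<comment> \<open>A common bound for both energies, with 1 added so that \<open>sqrt C\<close> is
    a positive radius for \<open>nonlin_functional_bound\<close>.\<close>
  define C where "C = B u u + B v v + 1"
  have C: "0 < C" "B u u \<le> (sqrt C)\<^sup>2" "B v v \<le> (sqrt C)\<^sup>2"
    using B_nonneg[of u] B_nonneg[of v] by (simp_all add: C_def)
  define L where "L \<phi> = a / p * (LINT x|lborel. nonlin a b u v x * \<phi> x) + f \<phi>" for \<phi>
  note int = integrable_nonlin_mult(1)[OF ab u v]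
  have "L \<in> dual_space X energy_norm"
    unfolding dual_space_def
  proof (intro CollectI conjI allI ballI exI)
    fix \<phi> \<psi> assume \<phi>: "\<phi> \<in> X" and \<psi>: "\<psi> \<in> X"
    show "L (\<lambda>x. \<phi> x + \<psi> x) = L \<phi> + L \<psi>"
      using int[OF \<phi>] int[OF \<psi>] by (simp add: L_def distrib_left dual_spaceD(1)[OF f \<phi> \<psi>])
  next
    fix c \<phi> assume \<phi>: "\<phi> \<in> X"
    have "(LINT x|lborel. nonlin a b u v x * (c * \<phi> x)) = (LINT x|lborel. c * (nonlin a b u v x * \<phi> x))"
      by (simp add: ac_simps)
    then show "L (\<lambda>x. c * \<phi> x) = c * L \<phi>"
      by (simp add: L_def dual_spaceD(2)[OF f \<phi>] distrib_left)
  next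
    fix \<phi> assume \<phi>: "\<phi> \<in> X"
    have "\<bar>L \<phi>\<bar> \<le> \<bar>a / p\<bar> * \<bar>LINT x|lborel. nonlin a b u v x * \<phi> x\<bar> + \<bar>f \<phi>\<bar>"
      unfolding L_def by (simp add: order_trans[OF abs_triangle_ineq] abs_mult)
    also have "\<dots> \<le> \<bar>a / p\<bar> * (3 * S * sqrt C powr (p - 1) * energy_norm \<phi>) +
        dual_norm X energy_norm f * energy_norm \<phi>"
      using C by (intro add_mono mult_left_mono abs_le_dual_norm[OF f \<phi>] nonlin_functional_bound[OF ab u v \<phi>]) auto
    finally show "\<bar>L \<phi>\<bar> \<le> (\<bar>a / p\<bar> * (3 * S * sqrt C powr (p - 1)) + dual_norm X energy_norm f) * energy_norm \<phi>"
      by (simp add: algebra_simps)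
  qed
  then obtain w where "w \<in> X" "\<And>\<phi>. \<phi> \<in> X \<Longrightarrow> B w \<phi> = L \<phi>" using riesz_representation by blast
  then show ?thesis unfolding solves_def L_def by blast
qed

text \<open>Test the equation with \<open>w\<close> itself. As \<open>a / p \<le> 1\<close>, the
  right-hand side is at most \<open>(3 * S * r powr (p - 1) + d) * energy_norm w\<close>, and one
  factor \<open>energy_norm w\<close> cancels.\<close>

lemma solves_bound:
  assumes ab: "1 < a" "1 < b" "a + b = p" and f: "f \<in> dual_space X energy_norm"
    and d: "dual_norm X energy_norm f \<le> d"
    and u: "u \<in> X" and v: "v \<in> X" and r: "0 < r" "B u u \<le> r\<^sup>2" "B v v \<le> r\<^sup>2"
    and small: "3 * S * r powr (p - 1) + d \<le> r"
    and w: "solves a b f u v w"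
  shows "B w w \<le> r\<^sup>2"
proof (cases "B w w = 0")
  case False
  have wX: "w \<in> X" using w by (simp add: solves_def)
  have pos: "energy_norm w > 0" using False B_nonneg[of w] by simp
  have ap: "0 \<le> a / p" "a / p \<le> 1" using ab by auto
  have "a / p * (LINT x|lborel. nonlin a b u v x * w x) \<le> a / p * \<bar>LINT x|lborel. nonlin a b u v x * w x\<bar>"
    using ap by (intro mult_left_mono) auto
  also have "\<dots> \<le> 1 * \<bar>LINT x|lborel. nonlin a b u v x * w x\<bar>" by (rule mult_right_mono[OF ap(2)]) simp
  also have "\<dots> \<le> 3 * S * r powr (p - 1) * energy_norm w"
    using nonlin_functional_bound[OF ab u v wX r] by simp
  finally have "B w w \<le> 3 * S * r powr (p - 1) * energy_norm w + \<bar>f w\<bar>"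
    using w wX by (simp add: solves_def)
  also have "\<bar>f w\<bar> \<le> d * energy_norm w"
    by (rule order_trans[OF abs_le_dual_norm[OF f wX]]) (use d pos in \<open>auto intro!: mult_right_mono\<close>)
  also have "3 * S * r powr (p - 1) * energy_norm w + d * energy_norm w \<le> r * energy_norm w"
    using mult_right_mono[OF small, of "energy_norm w"] pos by (simp add: distrib_right)
  finally have "energy_norm w * energy_norm w \<le> r * energy_norm w" using B_nonneg[of w] by simp
  then have "energy_norm w \<le> r" using pos by (rule mult_right_le_imp_le)
  then show ?thesis by (rule sqrt_le_D)
qed simp

text \<open>The functional \<open>f\<close> cancels in the difference \<open>w' - w\<close>, which
  is a supersolution because the nonlinearity is monotone.\<close>

lemma solves_mono:
  assumes ab: "1 < a" "1 < b" "a + b = p"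
    and X: "u \<in> X" "v \<in> X" "u' \<in> X" "v' \<in> X"
    and u: "AE x in lborel. 0 \<le> u x \<and> u x \<le> u' x" and v: "AE x in lborel. 0 \<le> v x \<and> v x \<le> v' x"
    and w: "solves a b f u v w" and w': "solves a b f u' v' w'"
  shows "AE x in lborel. w x \<le> w' x"
proof -
  have wX: "w \<in> X" "w' \<in> X" using w w' by (simp_all add: solves_def)
  have "AE x in lborel. 0 \<le> w' x - w x"
  proof (rule weak_maximum_principle)
    show "(\<lambda>x. w' x - w x) \<in> X" using wX by (intro X_diff)
    fix \<phi> assume \<phi>: "\<phi> \<in> X" "\<And>x. 0 \<le> \<phi> x"
    have "(LINT x|lborel. nonlin a b u v x * \<phi> x) \<le> (LINT x|lborel. nonlin a b u' v' x * \<phi> x)"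
    proof (rule integral_mono_AE)
      show "AE x in lborel. nonlin a b u v x * \<phi> x \<le> nonlin a b u' v' x * \<phi> x"
        using u v by eventually_elim (intro mult_right_mono nonlin_mono, use ab \<phi> in auto)
    qed (intro integrable_nonlin_mult(1) ab X \<phi>)+
    then have "a / p * (LINT x|lborel. nonlin a b u v x * \<phi> x) \<le> a / p * (LINT x|lborel. nonlin a b u' v' x * \<phi> x)"
      using ab p by (intro mult_left_mono) auto
    then show "0 \<le> B (\<lambda>x. w' x - w x) \<phi>"
      using w w' \<phi>(1) by (simp add: B_diff_left wX solves_def)
  qed
  then show ?thesis by simp
qed

section \<open>Monotone limits\<close>

lemma bounded_incseq_AE_convergent:
  assumes w: "\<And>n::nat. w n \<in> X" and e: "\<And>n. B (w n) (w n) \<le> e"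
    and nonneg: "\<And>n. AE x in lborel. 0 \<le> w n x" and mono: "\<And>n. AE x in lborel. w n x \<le> w (Suc n) x"
  shows "AE x in lborel. convergent (\<lambda>n. w n x)"
proof -
  note [measurable] = XD(1)[OF w]
  \<comment> \<open>Monotone convergence and Sobolev bound the integral of the supremum of the p-th
    powers, so this supremum is finite almost everywhere and the increasing sequence is bounded
    there.\<close>
  have "(\<integral>\<^sup>+x. (SUP n. ennreal (\<bar>w n x\<bar> powr p)) \<partial>lborel) = (SUP n. \<integral>\<^sup>+x. ennreal (\<bar>w n x\<bar> powr p) \<partial>lborel)"
  proof (rule nn_integral_monotone_convergence_SUP_AE)
    show "AE x in lborel. ennreal (\<bar>w n x\<bar> powr p) \<le> ennreal (\<bar>w (Suc n) x\<bar> powr p)" for n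
      using nonneg[of n] mono[of n] by eventually_elim (use p in \<open>auto intro!: ennreal_leI powr_mono2\<close>)
  qed measurable
  also have "\<dots> \<le> ennreal (S * e powr (p / 2))"
  proof (rule SUP_least)
    fix n show "(\<integral>\<^sup>+x. ennreal (\<bar>w n x\<bar> powr p) \<partial>lborel) \<le> ennreal (S * e powr (p / 2))"
      by (rule order_trans[OF nn_integral_powr[OF w]])
        (use e S p B_nonneg in \<open>auto intro!: ennreal_leI mult_left_mono powr_mono2\<close>)
  qed
  also have "\<dots> < \<infinity>" by simp
  finally have "AE x in lborel. (SUP n. ennreal (\<bar>w n x\<bar> powr p)) \<noteq> \<infinity>"
    by (intro nn_integral_noteq_infinite) auto
  moreover have "AE x in lborel. \<forall>n. w n x \<le> w (Suc n) x" using mono by (simp add: AE_all_countable)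
  ultimately show ?thesis
  proof eventually_elim
    case (elim x)
    define c where "c = enn2real (SUP n. ennreal (\<bar>w n x\<bar> powr p))"
    have c: "\<bar>w n x\<bar> powr p \<le> c" for n
    proof -
      have "ennreal (\<bar>w n x\<bar> powr p) \<le> (SUP n. ennreal (\<bar>w n x\<bar> powr p))" by (rule SUP_upper) simp
      also have "\<dots> = ennreal c" using elim(1) unfolding c_def by (simp only: infinity_ennreal_def ennreal_enn2real less_top)
      finally have "ennreal (\<bar>w n x\<bar> powr p) \<le> ennreal c" .
      then show ?thesis by (simp add: c_def)
    qed
    have "w n x \<le> 1 + c" for n
    proof (cases "\<bar>w n x\<bar> \<le> 1")
      case True
      then show ?thesis using c[of n] powr_ge_zero[of "\<bar>w n x\<bar>" p] by linarith
    next
      case False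
      then have "\<bar>w n x\<bar> powr 1 \<le> \<bar>w n x\<bar> powr p" using p by (intro powr_mono) auto
      then show ?thesis using c[of n] by simp
    qed
    then have "bdd_above (range (\<lambda>n. w n x))" by (intro bdd_aboveI2)
    moreover have "incseq (\<lambda>n. w n x)" using elim(2) by (intro incseq_SucI) auto
    ultimately show ?case using LIMSEQ_incseq_SUP convergentI by blast
  qed
qed

text \<open>
  The solution \<open>w\<close> of the limiting linear problem satisfies
  \<open>B (w - u (Suc n)) (w - u (Suc n)) \<longlonglongrightarrow> 0\<close>, hence it is the pointwise limit \<open>u'\<close>.
\<close>

lemma solves_limit:
  assumes ab: "1 < a" "1 < b" "a + b = p" and f: "f \<in> dual_space X energy_norm"
    and X: "\<And>n. u n \<in> X" "\<And>n. v n \<in> X" "u' \<in> X" "v' \<in> X"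
    and u: "AE x in lborel. \<forall>n. 0 \<le> u n x \<and> u n x \<le> u' x"
    and v: "AE x in lborel. \<forall>n. 0 \<le> v n x \<and> v n x \<le> v' x"
    and u_lim: "AE x in lborel. (\<lambda>n. u n x) \<longlonglongrightarrow> u' x" and v_lim: "AE x in lborel. (\<lambda>n. v n x) \<longlonglongrightarrow> v' x"
    and step: "\<And>n. solves a b f (u n) (v n) (u (Suc n))"
  shows "solves a b f u' v' u'"
proof -
  obtain w where w: "solves a b f u' v' w" using solves_exists[OF ab f X(3,4)] by blast
  then have wX: "w \<in> X" by (simp add: solves_def)
  note [measurable] = XD(1)[OF X(1)] XD(1)[OF X(2)] XD(1)[OF X(3)] XD(1)[OF X(4)] XD(1)[OF wX]
  \<comment> \<open>The index is \<open>Suc n\<close> because \<open>u (Suc n)\<close> solves the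
    problem with data \<open>u n\<close> and \<open>v n\<close>. Subtracting its equation from that
    of \<open>w\<close> removes \<open>f\<close>.\<close>
  define z where "z n x = w x - u (Suc n) x" for n x
  have z_eq: "z n = (\<lambda>x. w x - u (Suc n) x)" for n by (simp add: z_def fun_eq_iff)
  have zX: "z n \<in> X" for n unfolding z_eq by (intro X_diff wX X)
  have Bz: "B (z n) (z n) = a / p * (LINT x|lborel. (nonlin a b u' v' x - nonlin a b (u n) (v n) x) * z n x)" for n
  proof -
    have "B (z n) (z n) = B w (z n) - B (u (Suc n)) (z n)"
      using B_diff_left[OF wX X(1) zX, of "Suc n" n] by (simp flip: z_eq)
    also have "\<dots> = a / p * ((LINT x|lborel. nonlin a b u' v' x * z n x) - (LINT x|lborel. nonlin a b (u n) (v n) x * z n x))"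
      using w step[of n] zX by (simp add: solves_def right_diff_distrib)
    also have "(LINT x|lborel. nonlin a b u' v' x * z n x) - (LINT x|lborel. nonlin a b (u n) (v n) x * z n x) =
        (LINT x|lborel. nonlin a b u' v' x * z n x - nonlin a b (u n) (v n) x * z n x)"
      by (rule Bochner_Integration.integral_diff[symmetric]) (intro integrable_nonlin_mult(1) ab X zX)+
    finally show ?thesis by (simp add: left_diff_distrib)
  qed
  \<comment> \<open>The difference of nonlinear terms lies between 0 and
    \<open>nonlin a b u' v'\<close>, and \<open>\<bar>z n x\<bar>\<close> is at most
    \<open>\<bar>w x\<bar> + \<bar>u' x\<bar>\<close>. The product of the bounds is an integrable
    majorant free of \<open>n\<close>.\<close>
  have "(\<lambda>n. LINT x|lborel. (nonlin a b u' v' x - nonlin a b (u n) (v n) x) * z n x) \<longlonglongrightarrow> (LINT x::real ^ 'n|lborel. 0)"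
  proof (rule integral_dominated_convergence[where
        w = "\<lambda>x. \<bar>nonlin a b u' v' x * w x\<bar> + \<bar>nonlin a b u' v' x * u' x\<bar>"])
    have [measurable]: "z n \<in> borel_measurable borel" for n by (rule XD(1)[OF zX])
    show "(\<lambda>x. (nonlin a b u' v' x - nonlin a b (u n) (v n) x) * z n x) \<in> borel_measurable lborel" for n
      by measurable
    show "integrable lborel (\<lambda>x. \<bar>nonlin a b u' v' x * w x\<bar> + \<bar>nonlin a b u' v' x * u' x\<bar>)"
      by (intro Bochner_Integration.integrable_add integrable_abs integrable_nonlin_mult(1) ab X wX)
    show "AE x in lborel. (\<lambda>n. (nonlin a b u' v' x - nonlin a b (u n) (v n) x) * z n x) \<longlonglongrightarrow> 0"
      using u v u_lim v_lim
    proof eventually_elim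
      case (elim x)
      have "(\<lambda>n. (nonlin a b u' v' x - nonlin a b (u n) (v n) x) * z n x) \<longlonglongrightarrow>
          (nonlin a b u' v' x - nonlin a b u' v' x) * (w x - u' x)"
        unfolding z_def using elim ab
        by (intro tendsto_mult tendsto_diff tendsto_const nonlin_tendsto filterlim_sequentially_Suc[THEN iffD2]) auto
      then show ?case by simp
    qed
    show "AE x in lborel. norm ((nonlin a b u' v' x - nonlin a b (u n) (v n) x) * z n x) \<le>
        \<bar>nonlin a b u' v' x * w x\<bar> + \<bar>nonlin a b u' v' x * u' x\<bar>" for n
      using u v
    proof eventually_elim
      case (elim x)
      have "nonlin a b (u n) (v n) x \<le> nonlin a b u' v' x" using elim ab by (intro nonlin_mono) auto
      moreover have "0 \<le> nonlin a b (u n) (v n) x" using elim by (simp add: nonlin_nonneg)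
      ultimately have "\<bar>nonlin a b u' v' x - nonlin a b (u n) (v n) x\<bar> \<le> \<bar>nonlin a b u' v' x\<bar>" by linarith
      moreover have "\<bar>z n x\<bar> \<le> \<bar>w x\<bar> + \<bar>u' x\<bar>"
        using elim(1)[rule_format, of "Suc n"] unfolding z_def by linarith
      ultimately have "\<bar>nonlin a b u' v' x - nonlin a b (u n) (v n) x\<bar> * \<bar>z n x\<bar> \<le>
          \<bar>nonlin a b u' v' x\<bar> * (\<bar>w x\<bar> + \<bar>u' x\<bar>)" by (intro mult_mono) auto
      then show ?case by (simp add: abs_mult distrib_left)
    qed
  qed simp
  then have "(\<lambda>n. B (z n) (z n)) \<longlonglongrightarrow> 0" unfolding Bz by (intro tendsto_mult_right_zero) simp
  \<comment> \<open>The energies of \<open>z n\<close> are eventually below \<open>e\<close>, and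
    \<open>X_limit\<close> passes this bound, up to the factor 2, to the pointwise limit
    \<open>w - u'\<close>.\<close>
  have small: "B (\<lambda>x. w x - u' x) (\<lambda>x. w x - u' x) \<le> 2 * e" if "0 < e" for e
  proof -
    have "eventually (\<lambda>n. B (z n) (z n) < e) sequentially"
      using \<open>(\<lambda>n. B (z n) (z n)) \<longlonglongrightarrow> 0\<close> that by (rule order_tendstoD)
    then obtain k where k: "\<And>n. n \<ge> k \<Longrightarrow> B (z n) (z n) < e" unfolding eventually_sequentially by blast
    have "AE x in lborel. (\<lambda>n. z (n + k) x) \<longlonglongrightarrow> w x - u' x"
      using u_lim
    proof eventually_elim
      case (elim x)
      show ?case unfolding z_def using LIMSEQ_ignore_initial_segment[OF elim, of "Suc k"]
        by (intro tendsto_diff tendsto_const) simp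
    qed
    then show ?thesis
      using k by (intro X_limit(2)[of "\<lambda>n. z (n + k)" e]) (auto intro!: zX less_imp_le)
  qed
  have "B (\<lambda>x. w x - u' x) (\<lambda>x. w x - u' x) \<le> 0"
  proof (rule field_le_epsilon)
    fix e :: real assume "0 < e"
    then show "B (\<lambda>x. w x - u' x) (\<lambda>x. w x - u' x) \<le> 0 + e"
      using small[of "e / 2"] by simp
  qed
  then have "B (\<lambda>x. w x - u' x) (\<lambda>x. w x - u' x) = 0" using B_nonneg by (intro antisym)
  then have "AE x in lborel. w x - u' x = 0" by (rule B_eq_0_imp_AE[OF X_diff[OF wX X(3)]])
  then have "AE x in lborel. w x = u' x" by eventually_elim simp
  then have "B w \<phi> = B u' \<phi>" if "\<phi> \<in> X" for \<phi> using XD(1)[OF that] by (intro B_AE_cong) auto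
  then show ?thesis using w X(3) by (simp add: solves_def)
qed

lemma solves_nontrivial:
  assumes f: "nontrivial_functional X f" and sol: "solves a b f u v u"
  shows "\<not> (AE x in lborel. u x = 0)"
proof
  assume zero: "AE x in lborel. u x = 0"
  have uX: "u \<in> X" using sol by (simp add: solves_def)
  have "f \<phi> = 0" if \<phi>: "\<phi> \<in> X" for \<phi>
  proof -
    have "B u \<phi> = B (\<lambda>x. 0) \<phi>"
      using XD(1)[OF uX] XD(1)[OF \<phi>] zero by (intro B_AE_cong) auto
    also have "\<dots> = 0" using B_scale_left[of 0 "\<lambda>x. 0" \<phi>] by simp
    finally have "B u \<phi> = 0" .
    moreover have "AE x in lborel. nonlin a b u v x * \<phi> x = 0"
      using zero by eventually_elim (simp add: nonlin_def)
    then have "(LINT x|lborel. nonlin a b u v x * \<phi> x) = 0" by (rule integral_eq_zero_AE)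
    ultimately show ?thesis using sol \<phi> by (simp add: solves_def)
  qed
  then show False using f by (simp add: nontrivial_functional_def functional_eq_def)
qed

lemma solves_positive:
  assumes ab: "1 < a" "1 < b" "a + b = p"
    and f: "nonneg_functional X f" "nontrivial_functional X f"
    and u: "AE x in lborel. 0 \<le> u x" and sol: "solves a b f u v u"
  shows "ae_positive u"
  unfolding ae_positive_def
proof (rule strong_maximum_principle)
  show "u \<in> X" using sol by (simp add: solves_def)
  show "\<And>\<phi>. \<phi> \<in> X \<Longrightarrow> (\<And>x. 0 \<le> \<phi> x) \<Longrightarrow> 0 \<le> B u \<phi>"
    using solves_supersolution[OF ab f(1) u sol] by blast
qed (rule solves_nontrivial[OF f(2) sol])

lemma solution_exists_of_small_data:
  assumes ab: "1 < a" "1 < b" "a + b = p"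
    and r: "0 < r" "3 * S * r powr (p - 1) + d \<le> r"
    and f: "f \<in> dual_space X energy_norm" "nonneg_functional X f" "dual_norm X energy_norm f \<le> d"
    and g: "g \<in> dual_space X energy_norm" "nonneg_functional X g" "dual_norm X energy_norm g \<le> d"
  shows "\<exists>u v. solves a b f u v u \<and> solves b a g v u v \<and>
    (AE x in lborel. 0 \<le> u x) \<and> (AE x in lborel. 0 \<le> v x)"
proof -
  have ba: "b + a = p" using ab by simp
  \<comment> \<open>The invariant of the iteration: nonnegative and inside the ball of radius
    \<open>r\<close>.\<close>
  define good where "good w \<longleftrightarrow> w \<in> X \<and> B w w \<le> r\<^sup>2 \<and> (AE x in lborel. 0 \<le> w x)" for w
  have step: "\<exists>u' v'. good u' \<and> good v' \<and> solves a b f u v u' \<and> solves b a g v u v'"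
    if u: "good u" and v: "good v" for u v
  proof -
    obtain u' where u': "solves a b f u v u'"
      using solves_exists[OF ab f(1)] u v by (auto simp: good_def)
    obtain v' where v': "solves b a g v u v'"
      using solves_exists[OF ab(2,1) ba g(1)] u v by (auto simp: good_def)
    have "good u'" using u v u' solves_bound[OF ab f(1,3) _ _ r(1) _ _ r(2) u']
        solves_nonneg[OF ab f(2) _ u'] by (auto simp: good_def solves_def)
    moreover have "good v'" using u v v' solves_bound[OF ab(2,1) ba g(1,3) _ _ r(1) _ _ r(2) v']
        solves_nonneg[OF ab(2,1) ba g(2) _ v'] by (auto simp: good_def solves_def)
    ultimately show ?thesis using u' v' by blast
  qed
  have good0: "good (\<lambda>x. 0)" using X_zero r(1) B_scale_left[of 0 "\<lambda>x. 0" "\<lambda>x. 0"] by (simp add: good_def)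
  \<comment> \<open>\<open>dependent_nat_choice\<close> fixes the initial term only through its
    predicate, so the clause for \<open>n = 0\<close> pins the start at the zero pair. Monotonicity
    then begins with the nonnegativity of the first iterate.\<close>
  have "\<exists>z. \<forall>n. (good (fst (z n)) \<and> good (snd (z n)) \<and> (n = 0 \<longrightarrow> z n = (\<lambda>x. 0, \<lambda>x. 0))) \<and>
      solves a b f (fst (z n)) (snd (z n)) (fst (z (Suc n))) \<and>
      solves b a g (snd (z n)) (fst (z n)) (snd (z (Suc n)))"
  proof (rule dependent_nat_choice)
    show "\<exists>w. good (fst w) \<and> good (snd w) \<and> (0 = (0::nat) \<longrightarrow> w = (\<lambda>x. 0, \<lambda>x. 0))" using good0 by simp
    fix w and n :: nat
    assume "good (fst w) \<and> good (snd w) \<and> (n = 0 \<longrightarrow> w = (\<lambda>x. 0, \<lambda>x. 0))"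
    then obtain u' v' where "good u'" "good v'" "solves a b f (fst w) (snd w) u'" "solves b a g (snd w) (fst w) v'"
      using step by blast
    then show "\<exists>y. (good (fst y) \<and> good (snd y) \<and> (Suc n = 0 \<longrightarrow> y = (\<lambda>x. 0, \<lambda>x. 0))) \<and>
        solves a b f (fst w) (snd w) (fst y) \<and> solves b a g (snd w) (fst w) (snd y)"
      by (intro exI[of _ "(u', v')"]) simp
  qed
  then obtain z where z: "\<And>n. good (fst (z n))" "\<And>n. good (snd (z n))" "z 0 = (\<lambda>x. 0, \<lambda>x. 0)"
    "\<And>n. solves a b f (fst (z n)) (snd (z n)) (fst (z (Suc n)))"
    "\<And>n. solves b a g (snd (z n)) (fst (z n)) (snd (z (Suc n)))" by blast
  define u v where "u n = fst (z n)" and "v n = snd (z n)" for n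
  have u: "u n \<in> X" "B (u n) (u n) \<le> r\<^sup>2" "AE x in lborel. 0 \<le> u n x"
    and v: "v n \<in> X" "B (v n) (v n) \<le> r\<^sup>2" "AE x in lborel. 0 \<le> v n x" for n
    using z(1,2)[of n] by (auto simp: good_def u_def v_def)
  have su: "solves a b f (u n) (v n) (u (Suc n))" and sv: "solves b a g (v n) (u n) (v (Suc n))" for n
    using z(4,5)[of n] by (auto simp: u_def v_def)
  have mono: "(AE x in lborel. u n x \<le> u (Suc n) x) \<and> (AE x in lborel. v n x \<le> v (Suc n) x)" for n
  proof (induction n)
    case 0
    have "u 0 = (\<lambda>x. 0)" "v 0 = (\<lambda>x. 0)" using z(3) by (simp_all add: u_def v_def)
    then show ?case using u(3)[of "Suc 0"] v(3)[of "Suc 0"] by simp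
  next
    case (Suc n)
    have le: "AE x in lborel. 0 \<le> u n x \<and> u n x \<le> u (Suc n) x"
      "AE x in lborel. 0 \<le> v n x \<and> v n x \<le> v (Suc n) x"
      using Suc u(3) v(3) by simp_all
    show ?case
      by (intro conjI solves_mono[OF ab u(1) v(1) u(1) v(1) le su su]
          solves_mono[OF ab(2,1) ba v(1) u(1) v(1) u(1) le(2,1) sv sv])
  qed
  have limit: "\<exists>w'. w' \<in> X \<and> (AE x in lborel. (\<lambda>n. w n x) \<longlonglongrightarrow> w' x) \<and>
      (AE x in lborel. \<forall>n. 0 \<le> w n x \<and> w n x \<le> w' x)"
    if w: "\<And>n. w n \<in> X" "\<And>n. B (w n) (w n) \<le> r\<^sup>2" "\<And>n. AE x in lborel. 0 \<le> w n x"
      "\<And>n. AE x in lborel. w n x \<le> w (Suc n) x" for w :: "nat \<Rightarrow> _"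
  proof -
    note [measurable] = XD(1)[OF w(1)]
    define w' where "w' x = lim (\<lambda>n. w n x)" for x
    have [measurable]: "w' \<in> borel_measurable borel"
      unfolding w'_def by (rule borel_measurable_lim_metric) measurable
    have lim: "AE x in lborel. (\<lambda>n. w n x) \<longlonglongrightarrow> w' x"
      using bounded_incseq_AE_convergent[of w "r\<^sup>2"] w by (simp add: w'_def convergent_LIMSEQ_iff)
    have "w' \<in> X" by (rule X_limit(1)[OF w(1,2) _ lim]) measurable
    moreover have "AE x in lborel. \<forall>n. 0 \<le> w n x" "AE x in lborel. \<forall>n. w n x \<le> w (Suc n) x"
      using w(3,4) by (simp_all add: AE_all_countable)
    with lim have "AE x in lborel. \<forall>n. 0 \<le> w n x \<and> w n x \<le> w' x"
    proof eventually_elim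
      case (elim x)
      then have "incseq (\<lambda>n. w n x)" by (intro incseq_SucI) blast
      then have "w n x \<le> w' x" for n using elim by (intro incseq_le[of "\<lambda>n. w n x"]) auto
      with elim show ?case by simp
    qed
    ultimately show ?thesis using lim by blast
  qed
  obtain u' where u': "u' \<in> X" "AE x in lborel. (\<lambda>n. u n x) \<longlonglongrightarrow> u' x"
    "AE x in lborel. \<forall>n. 0 \<le> u n x \<and> u n x \<le> u' x"
    using limit[of u] u mono by blast
  obtain v' where v': "v' \<in> X" "AE x in lborel. (\<lambda>n. v n x) \<longlonglongrightarrow> v' x"
    "AE x in lborel. \<forall>n. 0 \<le> v n x \<and> v n x \<le> v' x"
    using limit[of v] v mono by blast
  have "solves a b f u' v' u'"
    by (rule solves_limit[OF ab f(1) u(1) v(1) u'(1) v'(1) u'(3) v'(3) u'(2) v'(2) su])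
  moreover have "solves b a g v' u' v'"
    by (rule solves_limit[OF ab(2,1) ba g(1) v(1) u(1) v'(1) u'(1) v'(3) u'(3) v'(2) u'(2) sv])
  moreover have "AE x in lborel. 0 \<le> u' x" using u'(3) by eventually_elim (blast intro: order_trans)
  moreover have "AE x in lborel. 0 \<le> v' x" using v'(3) by eventually_elim (blast intro: order_trans)
  ultimately show ?thesis by blast
qed

text \<open>The radius solves \<open>r powr (p - 2) = 1 / (6 * S + 1)\<close>, which makes the
  nonlinear part at most \<open>r / 2\<close> and leaves \<open>d = r / 2\<close> for the data. The
  added 1 covers \<open>S = 0\<close>.\<close>

lemma small_radius:
  obtains r d where "0 < r" "0 < d" "3 * S * r powr (p - 1) + d \<le> r"
proof -
  define r where "r = (1 / (6 * S + 1)) powr (1 / (p - 2))"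
  have r: "0 < r" using S by (simp add: r_def)
  have "r powr (p - 1) = r powr (p - 2) * r"
    using r powr_add[of r "p - 2" 1] by simp
  also have "r powr (p - 2) = 1 / (6 * S + 1)" using p S by (simp add: r_def powr_powr)
  finally have "3 * S * r powr (p - 1) = (3 * S / (6 * S + 1)) * r" by simp
  also have "\<dots> \<le> (1/2) * r" using r S by (intro mult_right_mono) (auto simp: field_simps)
  finally show thesis using that[of r "r / 2"] r by simp
qed

lemma equal_components_imp:
  assumes ab: "1 < a" "1 < b" "a + b = p"
    and u: "solves a b f u v u" and v: "solves b a g v u v"
    and eq: "ae_equal u v" and \<phi>: "\<phi> \<in> X"
  shows "(b - a) / p * (LINT x|lborel. \<bar>u x\<bar> powr (p - 2) * u x * \<phi> x) = f \<phi> - g \<phi>"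
proof -
  have uX: "u \<in> X" and vX: "v \<in> X" using u v by (simp_all add: solves_def)
  note [measurable] = XD(1)[OF uX] XD(1)[OF vX] XD(1)[OF \<phi>]
  have uv: "AE x in lborel. u x = v x" using eq by (simp add: ae_equal_def)
  have n: "nonlin c d y z x = \<bar>y x\<bar> powr (p - 2) * y x" if "y x = z x" "c + d = p"
    for c d x and y z :: "real ^ 'n \<Rightarrow> real"
  proof -
    have "\<bar>z x\<bar> powr (c - 2) * \<bar>z x\<bar> powr d = \<bar>z x\<bar> powr (p - 2)"
      using that(2) powr_add[of "\<bar>z x\<bar>" "c - 2" d] by (simp add: algebra_simps)
    then show ?thesis by (simp add: nonlin_def that(1) ac_simps)
  qed
  have "(LINT x|lborel. nonlin a b u v x * \<phi> x) = (LINT x|lborel. \<bar>u x\<bar> powr (p - 2) * u x * \<phi> x)"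
  proof (rule integral_cong_AE)
    show "AE x in lborel. nonlin a b u v x * \<phi> x = \<bar>u x\<bar> powr (p - 2) * u x * \<phi> x"
      using uv by eventually_elim (simp add: n ab)
  qed measurable
  moreover have "(LINT x|lborel. nonlin b a v u x * \<phi> x) = (LINT x|lborel. \<bar>u x\<bar> powr (p - 2) * u x * \<phi> x)"
  proof (rule integral_cong_AE)
    show "AE x in lborel. nonlin b a v u x * \<phi> x = \<bar>u x\<bar> powr (p - 2) * u x * \<phi> x"
      using uv by eventually_elim (use n ab in simp)
  qed measurable
  moreover have "B u \<phi> = B v \<phi>" using uv by (intro B_AE_cong) auto
  ultimately show ?thesis using u v \<phi> by (simp add: solves_def diff_divide_distrib left_diff_distrib)
qed

theorem coupled_system_solvable:
  assumes ab: "1 < a" "1 < b" "a + b = p"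
  obtains d where "0 < d"
    "\<And>f g. \<lbrakk>f \<in> dual_space X energy_norm; nonneg_functional X f; nontrivial_functional X f;
        dual_norm X energy_norm f \<le> d;
        g \<in> dual_space X energy_norm; nonneg_functional X g; nontrivial_functional X g;
        dual_norm X energy_norm g \<le> d\<rbrakk> \<Longrightarrow>
      \<exists>u v. solves a b f u v u \<and> solves b a g v u v \<and> ae_positive u \<and> ae_positive v \<and>
        nontrivial_pair u v \<and>
        (functional_eq X f g \<and> a \<noteq> b \<longrightarrow> \<not> ae_equal u v) \<and>
        (a = b \<and> \<not> functional_eq X f g \<longrightarrow> \<not> ae_equal u v)"
proof -
  obtain r d where rd: "0 < r" "0 < d" "3 * S * r powr (p - 1) + d \<le> r" by (rule small_radius)
  have ba: "b + a = p" using ab by simp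
  show thesis
  proof (rule that[OF rd(2)])
    fix f g
    assume f: "f \<in> dual_space X energy_norm" "nonneg_functional X f" "nontrivial_functional X f"
        "dual_norm X energy_norm f \<le> d"
      and g: "g \<in> dual_space X energy_norm" "nonneg_functional X g" "nontrivial_functional X g"
        "dual_norm X energy_norm g \<le> d"
    obtain u v where u: "solves a b f u v u" and v: "solves b a g v u v"
      and nonneg: "AE x in lborel. 0 \<le> u x" "AE x in lborel. 0 \<le> v x"
      using solution_exists_of_small_data[OF ab rd(1,3) f(1,2,4) g(1,2,4)] by blast
    have pos: "ae_positive u" by (rule solves_positive[OF ab f(2,3) nonneg(1) u])
    have pos': "ae_positive v" by (rule solves_positive[OF ab(2,1) ba g(2,3) nonneg(2) v])
    have nz: "\<not> ae_equal u (\<lambda>_. 0)"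
      unfolding ae_equal_def by (rule solves_nontrivial[OF f(3) u])
    have uX: "u \<in> X" using u by (simp add: solves_def)
    note diff = equal_components_imp[OF ab u v]
    have "\<not> ae_equal u v" if "functional_eq X f g" "a \<noteq> b"
    proof
      assume "ae_equal u v"
      \<comment> \<open>Testing the difference of the equations with \<open>u\<close> itself turns
        it into a nonzero multiple of the integral of \<open>\<bar>u\<bar> powr p\<close>.\<close>
      have "\<bar>u x\<bar> powr (p - 2) * u x * u x = \<bar>u x\<bar> powr p" for x
        using powr_add[of "\<bar>u x\<bar>" "p - 2" 2] by (simp add: powr_numeral power2_eq_square mult.assoc)
      then have "(LINT x|lborel. \<bar>u x\<bar> powr p) = 0"
        using diff[OF \<open>ae_equal u v\<close> uX] that uX p by (simp add: functional_eq_def)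
      then have "AE x in lborel. u x = 0" using integral_nonneg_eq_0_iff_AE[OF XD(2)[OF uX]] by simp
      with nz show False by (simp add: ae_equal_def)
    qed
    \<comment> \<open>For \<open>a = b\<close> the left-hand side of \<open>diff\<close> is 0 for
      every test function, so equal components would force \<open>f\<close> and \<open>g\<close> to
      agree.\<close>
    moreover have "\<not> ae_equal u v" if "a = b" "\<not> functional_eq X f g"
      using diff that by (auto simp: functional_eq_def)
    ultimately show "\<exists>u v. solves a b f u v u \<and> solves b a g v u v \<and> ae_positive u \<and> ae_positive v \<and>
      nontrivial_pair u v \<and>
      (functional_eq X f g \<and> a \<noteq> b \<longrightarrow> \<not> ae_equal u v) \<and>
      (a = b \<and> \<not> functional_eq X f g \<longrightarrow> \<not> ae_equal u v)"
      using u v pos pos' nz by (auto simp: nontrivial_pair_def)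
  qed
qed

end

section \<open>The critical and the subcritical case as instances\<close>

theorem theorem1p1:
  fixes s \<alpha> \<beta> :: real
  assumes "0 < s" and "s < 1"
    and "real CARD('n::finite) > 2 * s"
    and "\<alpha> > 1" and "\<beta> > 1"
    and "\<alpha> + \<beta> \<le> crit_exp CARD('n) s"
  shows
    "(\<alpha> + \<beta> = crit_exp CARD('n) s \<longrightarrow>
       (\<exists>d>0. \<forall>f g :: (real ^ 'n \<Rightarrow> real) \<Rightarrow> real.
          f \<in> dual_space (Hdot_space s) (Hdot_norm s) \<and> g \<in> dual_space (Hdot_space s) (Hdot_norm s) \<and>
          nontrivial_functional (Hdot_space s) f \<and> nontrivial_functional (Hdot_space s) g \<and>
          nonneg_functional (Hdot_space s) f \<and> nonneg_functional (Hdot_space s) g \<and>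
          functional_ker (Hdot_space s) f = functional_ker (Hdot_space s) g \<and>
          0 < max (dual_norm (Hdot_space s) (Hdot_norm s) f) (dual_norm (Hdot_space s) (Hdot_norm s) g) \<and>
          max (dual_norm (Hdot_space s) (Hdot_norm s) f) (dual_norm (Hdot_space s) (Hdot_norm s) g) \<le> d \<longrightarrow>
          (\<exists>u v. critical_solution s \<alpha> \<beta> f g u v \<and> nontrivial_pair u v \<and>
             ae_positive u \<and> ae_positive v \<and>
             (functional_eq (Hdot_space s) f g \<and> \<alpha> \<noteq> \<beta> \<longrightarrow> \<not> ae_equal u v) \<and>
             (\<alpha> = \<beta> \<and> \<not> functional_eq (Hdot_space s) f g \<longrightarrow> \<not> ae_equal u v)))) \<and>
     (\<alpha> + \<beta> < crit_exp CARD('n) s \<longrightarrow>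
       (\<exists>d>0. \<forall>f g :: (real ^ 'n \<Rightarrow> real) \<Rightarrow> real.
          f \<in> dual_space (H_space s) (H_norm s) \<and> g \<in> dual_space (H_space s) (H_norm s) \<and>
          nontrivial_functional (H_space s) f \<and> nontrivial_functional (H_space s) g \<and>
          nonneg_functional (H_space s) f \<and> nonneg_functional (H_space s) g \<and>
          functional_ker (H_space s) f = functional_ker (H_space s) g \<and>
          0 < max (dual_norm (H_space s) (H_norm s) f) (dual_norm (H_space s) (H_norm s) g) \<and>
          max (dual_norm (H_space s) (H_norm s) f) (dual_norm (H_space s) (H_norm s) g) \<le> d \<longrightarrow>
          (\<exists>u v. subcritical_solution s \<alpha> \<beta> f g u v \<and> nontrivial_pair u v \<and>
             ae_positive u \<and> ae_positive v \<and>
             (functional_eq (H_space s) f g \<and> \<alpha> \<noteq> \<beta> \<longrightarrow> \<not> ae_equal u v) \<and>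
             (\<alpha> = \<beta> \<and> \<not> functional_eq (H_space s) f g \<longrightarrow> \<not> ae_equal u v))))"
proof (intro conjI impI, goal_cases)
  have Ns: "2 * s < real CARD('n)" using assms(3) by simp
  note ab = assms(4,5)
  case 1
  note eq = 1
  obtain S where S: "0 \<le> S" "\<And>u :: real ^ 'n \<Rightarrow> real. u \<in> Hdot_space s \<Longrightarrow>
      (LINT x|lborel. \<bar>u x\<bar> powr crit_exp CARD('n) s) \<le> S * Hdot_inner s u u powr (crit_exp CARD('n) s / 2)"
    using fractional_sobolev[OF assms(1) Ns] by blast
  interpret fractional_energy s 0 "crit_exp CARD('n) s" S "Hdot_space s :: (real ^ 'n \<Rightarrow> real) set"
  proof
    show "2 < crit_exp CARD('n) s" using ab eq by simp
  qed (use S in \<open>auto simp: Hdot_space_def Lp_space_def\<close>)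
  \<comment> \<open>The two norms are equal as functions, so dual spaces and dual norms can be
    rewritten into those of the energy space.\<close>
  have norm: "Hdot_norm s = energy_norm" by (simp add: fun_eq_iff Hdot_norm_eq B_def)
  \<comment> \<open>The weak formulation for a pair of test functions is the sum of the two scalar
    equations.\<close>
  have sol: "critical_solution s \<alpha> \<beta> f g u v"
    if "solves \<alpha> \<beta> f u v u" "solves \<beta> \<alpha> g v u v" "ae_positive u" "ae_positive v" for f u v g
    using that by (simp add: critical_solution_def solves_def B_def nonlin_def)
  show ?case
    unfolding norm
  proof (rule coupled_system_solvable[OF ab eq], goal_cases)
    case (1 d)
    note solvable = 1(2)
    show ?case
    proof (intro exI[of _ d] conjI allI impI, goal_cases)
      case (2 f g)
      then have "\<exists>u v. solves \<alpha> \<beta> f u v u \<and> solves \<beta> \<alpha> g v u v \<and> ae_positive u \<and> ae_positive v \<and>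
          nontrivial_pair u v \<and>
          (functional_eq (Hdot_space s) f g \<and> \<alpha> \<noteq> \<beta> \<longrightarrow> \<not> ae_equal u v) \<and>
          (\<alpha> = \<beta> \<and> \<not> functional_eq (Hdot_space s) f g \<longrightarrow> \<not> ae_equal u v)"
        by (elim conjE, intro solvable) simp_all
      then obtain u v where "solves \<alpha> \<beta> f u v u" "solves \<beta> \<alpha> g v u v" "ae_positive u" "ae_positive v"
        and rest: "nontrivial_pair u v"
          "functional_eq (Hdot_space s) f g \<and> \<alpha> \<noteq> \<beta> \<longrightarrow> \<not> ae_equal u v"
          "\<alpha> = \<beta> \<and> \<not> functional_eq (Hdot_space s) f g \<longrightarrow> \<not> ae_equal u v"
        by (elim exE conjE)
      then show ?case by (intro exI[of _ u] exI[of _ v] conjI sol rest)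
    qed (rule 1(1))
  qed
next
  have Ns: "2 * s < real CARD('n)" using assms(3) by simp
  note ab = assms(4,5)
  case 2
  have p: "2 < \<alpha> + \<beta>" using ab by simp
  obtain S where S: "0 \<le> S"
    "\<And>u :: real ^ 'n \<Rightarrow> real. u \<in> H_space s \<Longrightarrow> integrable lborel (\<lambda>x. \<bar>u x\<bar> powr (\<alpha> + \<beta>))"
    "\<And>u :: real ^ 'n \<Rightarrow> real. u \<in> H_space s \<Longrightarrow> (LINT x|lborel. \<bar>u x\<bar> powr (\<alpha> + \<beta>)) \<le>
      S * (Hdot_inner s u u + L2_inner u u) powr ((\<alpha> + \<beta>) / 2)"
    using subcritical_sobolev[OF assms(1) Ns p assms(6)] by blast
  interpret fractional_energy s 1 "\<alpha> + \<beta>" S "H_space s :: (real ^ 'n \<Rightarrow> real) set"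
  proof
    \<comment> \<open>For \<open>\<gamma> = 1\<close> the p-th power clause of \<open>X_eq\<close>
      holds on all of \<open>H_space\<close> by the subcritical Sobolev embedding.\<close>
    show "H_space s = {u :: real ^ 'n \<Rightarrow> real. u \<in> borel_measurable borel \<and>
        integrable lborel (\<lambda>x. \<bar>u x\<bar> powr (\<alpha> + \<beta>)) \<and> integrable lborel (\<lambda>x. 1 * (u x)\<^sup>2) \<and> finite_gagliardo s u}"
      using S(2) by (auto simp: H_space_def Lp_space_def)
  qed (use S p in auto)
  have norm: "H_norm s = energy_norm"
    by (simp add: fun_eq_iff H_norm_def Hdot_norm_eq Hdot_inner_nonneg B_def add.commute)
  have sol: "subcritical_solution s \<alpha> \<beta> f g u v"
    if "solves \<alpha> \<beta> f u v u" "solves \<beta> \<alpha> g v u v" "ae_positive u" "ae_positive v" for f u v g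
    unfolding subcritical_solution_def
  proof (intro conjI ballI)
    fix \<phi> \<psi> :: "real ^ 'n \<Rightarrow> real" assume "\<phi> \<in> H_space s" "\<psi> \<in> H_space s"
    then have "B u \<phi> + B v \<psi> =
        \<alpha> / (\<alpha> + \<beta>) * (LINT x|lborel. nonlin \<alpha> \<beta> u v x * \<phi> x) + f \<phi> +
        (\<beta> / (\<alpha> + \<beta>) * (LINT x|lborel. nonlin \<beta> \<alpha> v u x * \<psi> x) + g \<psi>)"
      using that(1,2) by (simp add: solves_def)
    then show "Hdot_inner s u \<phi> + Hdot_inner s v \<psi> + L2_inner u \<phi> + L2_inner v \<psi> =
         \<alpha> / (\<alpha> + \<beta>) *
           (LINT x|lborel. \<bar>u x\<bar> powr (\<alpha> - 2) * u x * \<bar>v x\<bar> powr \<beta> * \<phi> x)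
         + \<beta> / (\<alpha> + \<beta>) *
           (LINT x|lborel. \<bar>v x\<bar> powr (\<beta> - 2) * v x * \<bar>u x\<bar> powr \<alpha> * \<psi> x)
         + f \<phi> + g \<psi>"
      unfolding B_def nonlin_def by simp
  qed (use that in \<open>simp_all add: solves_def\<close>)
  show ?case
    unfolding norm
  proof (rule coupled_system_solvable[OF ab refl], goal_cases)
    case (1 d)
    note solvable = 1(2)
    show ?case
    proof (intro exI[of _ d] conjI allI impI, goal_cases)
      case (2 f g)
      then have "\<exists>u v. solves \<alpha> \<beta> f u v u \<and> solves \<beta> \<alpha> g v u v \<and> ae_positive u \<and> ae_positive v \<and>
          nontrivial_pair u v \<and>
          (functional_eq (H_space s) f g \<and> \<alpha> \<noteq> \<beta> \<longrightarrow> \<not> ae_equal u v) \<and>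
          (\<alpha> = \<beta> \<and> \<not> functional_eq (H_space s) f g \<longrightarrow> \<not> ae_equal u v)"
        by (elim conjE, intro solvable) simp_all
      then obtain u v where "solves \<alpha> \<beta> f u v u" "solves \<beta> \<alpha> g v u v" "ae_positive u" "ae_positive v"
        and rest: "nontrivial_pair u v"
          "functional_eq (H_space s) f g \<and> \<alpha> \<noteq> \<beta> \<longrightarrow> \<not> ae_equal u v"
          "\<alpha> = \<beta> \<and> \<not> functional_eq (H_space s) f g \<longrightarrow> \<not> ae_equal u v"
        by (elim exE conjE)
      then show ?case by (intro exI[of _ u] exI[of _ v] conjI sol rest)
    qed (rule 1(1))
  qed
qed

end
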